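(* Let $\delta,\varepsilon>0$. Any minimizer $v_{\delta,\varepsilon}$ of $J_{\delta,\varepsilon}$ over $\mathcal{K}$ satisfies the variational inequality $$J'_{\delta,\varepsilon}(v_{\delta,\varepsilon})[\omega-v_{\delta,\varepsilon}]\ge 0\qquad\forall\,\omega\in\mathcal{K},$$ where, for $v\in\mathcal{K}$ and $\vartheta\in\mathcal{K}-v:=\{z: z+v\in\mathcal{K}\}$, $$\begin{aligned}J'_{\delta,\varepsilon}(v)[\vartheta]=&\frac12\int_\Omega\vartheta(\mathbb{C}_1-\mathbb{C}_0)\widehat\nabla u^\delta_D(v):\widehat\nabla u^\delta_D(v)\,dx-\frac12\int_\Omega\vartheta(\mathbb{C}_1-\mathbb{C}_0)\widehat\nabla u^\delta_N(v):\widehat\nabla u^\delta_N(v)\,dx\\&+2\gamma\varepsilon\int_\Omega\nabla v\cdot\nabla\vartheta\,dx+\frac{\gamma}{\varepsilon}\int_\Omega(1-2v)\vartheta\,dx.\end{aligned}$$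
   Context: Let $d\in\{2,3\}$. Displacement fields take values in $\mathbb{R}^d$; $A:B=\sum a_{ij}b_{ij}$, $\widehat A=\frac12(A+A^T)$, $\widehat\nabla u=\frac12(\nabla u+(\nabla u)^T)$. $\Omega\subset\mathbb{R}^d$ is a bounded Lipschitz domain, $\partial\Omega=\Sigma_N\cup\Sigma_D$ with $|\Sigma_N|,|\Sigma_D|>0$ and $\Sigma_D$ closed. $\mathbb{C}_0=\mathbb{C}_0(x)$ is a uniformly bounded fourth-order tensor field on $\Omega$ with $(\mathbb{C}_0)_{ijkh}=(\mathbb{C}_0)_{jikh}=(\mathbb{C}_0)_{khij}$ and, for some $\xi_0>0$, $\mathbb{C}_0(x)\widehat A:\widehat A\ge\xi_0|\widehat A|^2$ a.e. in $\Omega$ for all matrices $A$. $g\in L^2(\Sigma_N)$. $f$ is a measured boundary displacement on $\Sigma_N$: it is the trace on $\Sigma_N$ of an $H^1$ displacement field (the solution of the elasticity problem with the true cavity) vanishing on $\Sigma_D$; $u^f\in H^1(\Omega)$ is a lifting with trace $f$ on $\Sigma_N$ and $0$ on $\Sigma_D$. $\delta>0$ is a fixed (small) parameter, $\mathbb{C}_1=\delta\mathbb{C}_0$, $\mathbb{C}^\delta(v)=\mathbb{C}_0+(\mathbb{C}_1-\mathbb{C}_0)v$. $H^1_{\Sigma_D}(\Omega)$ denotes $H^1$ fields with zero trace on $\Sigma_D$. For $v$ with $0\le v\le1$ a.e., $u^\delta_N(v)\in H^1_{\Sigma_D}(\Omega)$ solves $\int_\Omega\mathbb{C}^\delta(v)\widehat\nabla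 u^\delta_N(v):\widehat\nabla\varphi\,dx=\int_{\Sigma_N}g\cdot\varphi\,d\sigma$ for all $\varphi\in H^1_{\Sigma_D}(\Omega)$; $u^\delta_D(v)\in u^f+H^1_0(\Omega)$ solves $\int_\Omega\mathbb{C}^\delta(v)\widehat\nabla u^\delta_D(v):\widehat\nabla\psi\,dx=0$ for all $\psi\in H^1_0(\Omega)$. $\Omega^{d_0}=\{x\in\Omega:\mathrm{dist}(x,\partial\Omega)\le d_0\}$ for a fixed $d_0>0$, and $\mathcal{K}=\{v\in H^1(\Omega):0\le v\le1\text{ a.e. in }\Omega,\ v=0\text{ a.e. in }\Omega^{d_0}\}$ (scalar functions). $$J_{\delta,\varepsilon}(v)=\overline J_{ND}+J^\delta_N(v)+J^\delta_D(v)+\gamma\int_\Omega\Big(\varepsilon|\nabla v|^2+\frac1\varepsilon v(1-v)\Big)dx,$$ with $\overline J_{ND}=-\int_{\Sigma_N}g\cdot f\,d\sigma$, $J^\delta_N(v)=\frac12\int_\Omega\mathbb{C}^\delta(v)\widehat\nabla u^\delta_N(v):\widehat\nabla u^\delta_N(v)\,dx$, $J^\delta_D(v)=\frac12\int_\Omega\mathbb{C}^\delta(v)\widehat\nabla u^\delta_D(v):\widehat\nabla u^\delta_D(v)\,dx$, and $\gamma=\frac4\pi\alpha$ for a fixed $\alpha>0$. $J'_{\delta,\varepsilon}(v)[\vartheta]$ denotes the Fréchet derivative of $J_{\delta,\varepsilon}$ at $v$ in the admissible direction $\vartheta$, with $\mathcal{K}$ regarded as a convex subset of $L^\infty(\Omega)\cap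 H^1(\Omega)$. *)

theory Defs
  imports "HOL-Analysis.Analysis" "HOL-Probability.Essential_Supremum"
begin

section \<open>Function spaces\<close>

text \<open>Elements of the Lebesgue and Sobolev spaces are represented by functions defined on the whole
  space, of which only the values almost everywhere in the domain matter.\<close>

definition L2 :: "'a measure \<Rightarrow> ('a \<Rightarrow> 'b::euclidean_space) set" where
  "L2 M = {u. u \<in> borel_measurable M \<and> integrable M (\<lambda>x. (norm (u x))\<^sup>2)}"

primrec Ck :: "nat \<Rightarrow> ('a::euclidean_space \<Rightarrow> 'b::real_normed_vector) \<Rightarrow> bool" where
  "Ck 0 u \<longleftrightarrow> continuous_on UNIV u"
| "Ck (Suc k) u \<longleftrightarrow> (\<forall>x. u differentiable (at x)) \<and>
     (\<forall>b\<in>Basis. Ck k (\<lambda>x. frechet_derivative u (at x) b))"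

definition smooth :: "('a::euclidean_space \<Rightarrow> 'b::real_normed_vector) \<Rightarrow> bool" where
  "smooth u \<longleftrightarrow> (\<forall>k. Ck k u)"

definition test_functions :: "'a::euclidean_space set \<Rightarrow> ('a \<Rightarrow> 'b::real_normed_vector) set" where
  "test_functions \<Omega> = {\<phi>. smooth \<phi> \<and> (\<exists>S. compact S \<and> S \<subseteq> \<Omega> \<and> (\<forall>x. x \<notin> S \<longrightarrow> \<phi> x = 0))}"

definition has_weak_partial ::
    "(real^'n::finite) set \<Rightarrow> 'n \<Rightarrow> (real^'n \<Rightarrow> 'b::euclidean_space) \<Rightarrow> (real^'n \<Rightarrow> 'b) \<Rightarrow> bool" where
  "has_weak_partial \<Omega> i u w \<longleftrightarrow> (\<forall>\<phi>\<in>test_functions \<Omega>.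
     (LINT x|lebesgue_on \<Omega>. frechet_derivative \<phi> (at x) (axis i (1::real)) *\<^sub>R u x)
       = - (LINT x|lebesgue_on \<Omega>. (\<phi> x :: real) *\<^sub>R w x))"

definition H1 :: "(real^'n::finite) set \<Rightarrow> (real^'n \<Rightarrow> 'b::euclidean_space) set" where
  "H1 \<Omega> = {u. u \<in> L2 (lebesgue_on \<Omega>) \<and>
     (\<forall>i. \<exists>w. w \<in> L2 (lebesgue_on \<Omega>) \<and> has_weak_partial \<Omega> i u w)}"

text \<open>A representative of the weak partial derivative, which is unique almost everywhere.\<close>

definition weak_partial ::
    "(real^'n::finite) set \<Rightarrow> 'n \<Rightarrow> (real^'n \<Rightarrow> 'b::euclidean_space) \<Rightarrow> real^'n \<Rightarrow> 'b" where
  "weak_partial \<Omega> i u = (SOME w. w \<in> L2 (lebesgue_on \<Omega>) \<and> has_weak_partial \<Omega> i u w)"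

definition H1_norm :: "(real^'n::finite) set \<Rightarrow> (real^'n \<Rightarrow> 'b::euclidean_space) \<Rightarrow> real" where
  "H1_norm \<Omega> u = sqrt ((LINT x|lebesgue_on \<Omega>. (norm (u x))\<^sup>2)
     + (\<Sum>i\<in>UNIV. LINT x|lebesgue_on \<Omega>. (norm (weak_partial \<Omega> i u x))\<^sup>2))"

definition H1_0 :: "(real^'n::finite) set \<Rightarrow> (real^'n \<Rightarrow> 'b::euclidean_space) set" where
  "H1_0 \<Omega> = {u \<in> H1 \<Omega>. \<exists>U. (\<forall>k. U k \<in> test_functions \<Omega>) \<and>
     (\<lambda>k. H1_norm \<Omega> (\<lambda>x. u x - U k x)) \<longlonglongrightarrow> 0}"

definition weak_grad :: "(real^'n::finite) set \<Rightarrow> (real^'n \<Rightarrow> real) \<Rightarrow> real^'n \<Rightarrow> real^'n" where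
  "weak_grad \<Omega> v x = (\<chi> i. weak_partial \<Omega> i v x)"

text \<open>\<open>(\<nabla>u) $ i $ j\<close> is the \<open>j\<close>-th partial derivative of the \<open>i\<close>-th component.\<close>

definition weak_jacobian ::
    "(real^'n::finite) set \<Rightarrow> (real^'n \<Rightarrow> real^'n) \<Rightarrow> real^'n \<Rightarrow> real^'n^'n" where
  "weak_jacobian \<Omega> u x = (\<chi> i j. weak_partial \<Omega> j u x $ i)"

definition sym_part :: "real^'n^'n \<Rightarrow> real^'n^'n" where
  "sym_part A = (1/2) *\<^sub>R (A + transpose A)"

definition strain :: "(real^'n::finite) set \<Rightarrow> (real^'n \<Rightarrow> real^'n) \<Rightarrow> real^'n \<Rightarrow> real^'n^'n" where
  "strain \<Omega> u x = sym_part (weak_jacobian \<Omega> u x)"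

definition Linf :: "'a measure \<Rightarrow> ('a \<Rightarrow> real) set" where
  "Linf M = {u. u \<in> borel_measurable M \<and> esssup M (\<lambda>x. ereal \<bar>u x\<bar>) < \<infinity>}"

definition Linf_norm :: "'a measure \<Rightarrow> ('a \<Rightarrow> real) \<Rightarrow> real" where
  "Linf_norm M u = real_of_ereal (esssup M (\<lambda>x. ereal \<bar>u x\<bar>))"

section \<open>Lipschitz domains, surface measure and traces\<close>

text \<open>Near each boundary point the domain is the strict epigraph, in some unit direction \<open>e\<close>,
  of a Lipschitz function on the hyperplane orthogonal to \<open>e\<close>.\<close>

definition bounded_lipschitz_domain :: "'a::euclidean_space set \<Rightarrow> bool" where
  "bounded_lipschitz_domain \<Omega> \<longleftrightarrow> open \<Omega> \<and> connected \<Omega> \<and> bounded \<Omega> \<and> \<Omega> \<noteq> {} \<and>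
     (\<forall>p\<in>frontier \<Omega>. \<exists>e \<psi> L r. norm e = 1 \<and> r > 0 \<and> L-lipschitz_on {y. y \<bullet> e = 0} \<psi> \<and>
        \<Omega> \<inter> ball p r = {x \<in> ball p r. \<psi> (x - (x \<bullet> e) *\<^sub>R e) < x \<bullet> e})"

text \<open>Hausdorff measure of dimension \<open>s \<ge> 1\<close>, normalised so that it agrees with the
  \<open>s\<close>-dimensional area.\<close>

definition hausdorff_pre :: "nat \<Rightarrow> real \<Rightarrow> 'a::metric_space set \<Rightarrow> ennreal" where
  "hausdorff_pre s r A =
     (INF C\<in>{C :: nat \<Rightarrow> 'a set. A \<subseteq> (\<Union>k. C k) \<and> (\<forall>k. bounded (C k) \<and> diameter (C k) \<le> r)}.
        (\<Sum>k. ennreal (unit_ball_vol (real s) * (diameter (C k) / 2) ^ s)))"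

definition hausdorff_outer :: "nat \<Rightarrow> 'a::metric_space set \<Rightarrow> ennreal" where
  "hausdorff_outer s A = (SUP r\<in>{0<..}. hausdorff_pre s r A)"

definition surface_measure :: "(real^'n::finite) measure" where
  "surface_measure = completion (measure_of UNIV (sets borel) (hausdorff_outer (CARD('n) - 1)))"

definition surface_on :: "(real^'n::finite) set \<Rightarrow> (real^'n) measure" where
  "surface_on S = restrict_space surface_measure S"

text \<open>The trace operator is the continuous extension to \<open>H1\<close> of the restriction to the boundary of
  functions smooth up to the boundary, which are dense for a bounded Lipschitz domain.\<close>

definition has_trace ::
    "(real^'n::finite) set \<Rightarrow> (real^'n \<Rightarrow> 'b::euclidean_space) \<Rightarrow> (real^'n \<Rightarrow> 'b) \<Rightarrow> bool" where
  "has_trace \<Omega> u h \<longleftrightarrow> h \<in> L2 (surface_on (frontier \<Omega>)) \<and>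
     (\<exists>U. (\<forall>k. smooth (U k)) \<and>
        (\<lambda>k. H1_norm \<Omega> (\<lambda>x. u x - U k x)) \<longlonglongrightarrow> 0 \<and>
        (\<lambda>k. LINT x|surface_on (frontier \<Omega>). (norm (h x - U k x))\<^sup>2) \<longlonglongrightarrow> 0)"

definition bdry_trace :: "(real^'n::finite) set \<Rightarrow> (real^'n \<Rightarrow> 'b::euclidean_space) \<Rightarrow> real^'n \<Rightarrow> 'b" where
  "bdry_trace \<Omega> u = (SOME h. has_trace \<Omega> u h)"

definition H1_vanishing_on ::
    "(real^'n::finite) set \<Rightarrow> (real^'n) set \<Rightarrow> (real^'n \<Rightarrow> 'b::euclidean_space) set" where
  "H1_vanishing_on \<Omega> \<Sigma> = {u \<in> H1 \<Omega>. AE x in surface_on \<Sigma>. bdry_trace \<Omega> u x = 0}"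

section \<open>Elasticity tensors and the two boundary value problems\<close>

text \<open>A fourth-order tensor is an element of \<open>real^'n^'n^'n^'n\<close>; the product \<open>A : B\<close> of matrices
  is the inner product \<open>A \<bullet> B\<close> of \<open>real^'n^'n\<close>.\<close>

definition tensor_apply :: "real^'n^'n^'n^'n \<Rightarrow> real^'n^'n \<Rightarrow> real^'n^'n::finite" where
  "tensor_apply C A = (\<chi> i j. \<Sum>k\<in>UNIV. \<Sum>h\<in>UNIV. C $ i $ j $ k $ h * A $ k $ h)"

definition elasticity_tensor ::
    "(real^'n::finite) set \<Rightarrow> real \<Rightarrow> (real^'n \<Rightarrow> real^'n^'n^'n^'n) \<Rightarrow> bool" where
  "elasticity_tensor \<Omega> \<xi> C \<longleftrightarrow>
     C \<in> borel_measurable (lebesgue_on \<Omega>) \<and>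
     (\<exists>B. AE x in lebesgue_on \<Omega>. norm (C x) \<le> B) \<and>
     (AE x in lebesgue_on \<Omega>. \<forall>i j k h.
        C x $ i $ j $ k $ h = C x $ j $ i $ k $ h \<and> C x $ i $ j $ k $ h = C x $ k $ h $ i $ j) \<and>
     (AE x in lebesgue_on \<Omega>. \<forall>A.
        tensor_apply (C x) (sym_part A) \<bullet> sym_part A \<ge> \<xi> * (norm (sym_part A))\<^sup>2)"

definition C_delta ::
    "(real^'n::finite \<Rightarrow> real^'n^'n^'n^'n) \<Rightarrow> real \<Rightarrow> (real^'n \<Rightarrow> real) \<Rightarrow> real^'n \<Rightarrow> real^'n^'n^'n^'n" where
  "C_delta C0 \<delta> v x = C0 x + v x *\<^sub>R (\<delta> *\<^sub>R C0 x - C0 x)"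

definition elastic_form ::
    "(real^'n::finite) set \<Rightarrow> (real^'n \<Rightarrow> real^'n^'n^'n^'n) \<Rightarrow>
     (real^'n \<Rightarrow> real^'n) \<Rightarrow> (real^'n \<Rightarrow> real^'n) \<Rightarrow> real" where
  "elastic_form \<Omega> C u w = (LINT x|lebesgue_on \<Omega>. tensor_apply (C x) (strain \<Omega> u x) \<bullet> strain \<Omega> w x)"

definition phase_functions :: "(real^'n::finite) set \<Rightarrow> (real^'n \<Rightarrow> real) set" where
  "phase_functions \<Omega> = {v. v \<in> borel_measurable (lebesgue_on \<Omega>) \<and>
     (AE x in lebesgue_on \<Omega>. 0 \<le> v x \<and> v x \<le> 1)}"

definition neumann_solution ::
    "(real^'n::finite) set \<Rightarrow> (real^'n) set \<Rightarrow> (real^'n) set \<Rightarrow> (real^'n \<Rightarrow> real^'n) \<Rightarrow>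
     (real^'n \<Rightarrow> real^'n^'n^'n^'n) \<Rightarrow> (real^'n \<Rightarrow> real^'n) \<Rightarrow> bool" where
  "neumann_solution \<Omega> \<Sigma>N \<Sigma>D g C u \<longleftrightarrow> u \<in> H1_vanishing_on \<Omega> \<Sigma>D \<and>
     (\<forall>\<phi>\<in>H1_vanishing_on \<Omega> \<Sigma>D.
        elastic_form \<Omega> C u \<phi> = (LINT x|surface_on \<Sigma>N. g x \<bullet> bdry_trace \<Omega> \<phi> x))"

definition dirichlet_solution ::
    "(real^'n::finite) set \<Rightarrow> (real^'n \<Rightarrow> real^'n) \<Rightarrow>
     (real^'n \<Rightarrow> real^'n^'n^'n^'n) \<Rightarrow> (real^'n \<Rightarrow> real^'n) \<Rightarrow> bool" where
  "dirichlet_solution \<Omega> uf C u \<longleftrightarrow> u \<in> H1 \<Omega> \<and> (\<lambda>x. u x - uf x) \<in> H1_0 \<Omega> \<and>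
     (\<forall>\<psi>\<in>H1_0 \<Omega>. elastic_form \<Omega> C u \<psi> = 0)"

section \<open>The phase-field functional\<close>

definition boundary_layer :: "'a::euclidean_space set \<Rightarrow> real \<Rightarrow> 'a set" where
  "boundary_layer \<Omega> d0 = {x \<in> \<Omega>. infdist x (frontier \<Omega>) \<le> d0}"

definition K_set :: "(real^'n::finite) set \<Rightarrow> real \<Rightarrow> (real^'n \<Rightarrow> real) set" where
  "K_set \<Omega> d0 = {v \<in> H1 \<Omega>. (AE x in lebesgue_on \<Omega>. 0 \<le> v x \<and> v x \<le> 1) \<and>
     (AE x in lebesgue_on \<Omega>. x \<in> boundary_layer \<Omega> d0 \<longrightarrow> v x = 0)}"

text \<open>\<open>uN\<close> and \<open>uD\<close> are the solution maps of the Neumann and the Dirichlet problem.\<close>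

definition J_func ::
    "(real^'n::finite) set \<Rightarrow> (real^'n) set \<Rightarrow> (real^'n \<Rightarrow> real^'n^'n^'n^'n) \<Rightarrow>
     (real^'n \<Rightarrow> real^'n) \<Rightarrow> (real^'n \<Rightarrow> real^'n) \<Rightarrow>
     ((real^'n \<Rightarrow> real) \<Rightarrow> real^'n \<Rightarrow> real^'n) \<Rightarrow> ((real^'n \<Rightarrow> real) \<Rightarrow> real^'n \<Rightarrow> real^'n) \<Rightarrow>
     real \<Rightarrow> real \<Rightarrow> real \<Rightarrow> (real^'n \<Rightarrow> real) \<Rightarrow> real" where
  "J_func \<Omega> \<Sigma>N C0 g f uN uD \<gamma> \<delta> \<epsilon> v =
     - (LINT x|surface_on \<Sigma>N. g x \<bullet> f x)
     + 1/2 * elastic_form \<Omega> (C_delta C0 \<delta> v) (uN v) (uN v)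
     + 1/2 * elastic_form \<Omega> (C_delta C0 \<delta> v) (uD v) (uD v)
     + \<gamma> * (LINT x|lebesgue_on \<Omega>. \<epsilon> * (norm (weak_grad \<Omega> v x))\<^sup>2 + 1/\<epsilon> * (v x * (1 - v x)))"

section \<open>Derivative relative to a convex set in the intersection of L-infinity and H1\<close>

definition X_space :: "(real^'n::finite) set \<Rightarrow> (real^'n \<Rightarrow> real) set" where
  "X_space \<Omega> = Linf (lebesgue_on \<Omega>) \<inter> H1 \<Omega>"

definition X_norm :: "(real^'n::finite) set \<Rightarrow> (real^'n \<Rightarrow> real) \<Rightarrow> real" where
  "X_norm \<Omega> z = Linf_norm (lebesgue_on \<Omega>) z + H1_norm \<Omega> z"

definition admissible_directions :: "('a \<Rightarrow> real) set \<Rightarrow> ('a \<Rightarrow> real) \<Rightarrow> ('a \<Rightarrow> real) set" where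
  "admissible_directions K v = {z. (\<lambda>x. z x + v x) \<in> K}"

definition has_frechet_deriv_in ::
    "(real^'n::finite) set \<Rightarrow> (real^'n \<Rightarrow> real) set \<Rightarrow> ((real^'n \<Rightarrow> real) \<Rightarrow> real) \<Rightarrow>
     (real^'n \<Rightarrow> real) \<Rightarrow> ((real^'n \<Rightarrow> real) \<Rightarrow> real) \<Rightarrow> bool" where
  "has_frechet_deriv_in \<Omega> K J v D \<longleftrightarrow>
     (\<forall>z\<in>X_space \<Omega>. \<forall>w\<in>X_space \<Omega>. \<forall>a b. D (\<lambda>x. a * z x + b * w x) = a * D z + b * D w) \<and>
     (\<exists>B. \<forall>z\<in>X_space \<Omega>. \<bar>D z\<bar> \<le> B * X_norm \<Omega> z) \<and>
     (\<forall>e>0. \<exists>r>0. \<forall>z\<in>admissible_directions K v. X_norm \<Omega> z < r \<longrightarrow>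
        \<bar>J (\<lambda>x. v x + z x) - J v - D z\<bar> \<le> e * X_norm \<Omega> z)"

text \<open>As for the library constant \<^const>\<open>frechet_derivative\<close>. The value is determined by the
  functional only on admissible directions (and their linear combinations).\<close>

definition frechet_deriv_in ::
    "(real^'n::finite) set \<Rightarrow> (real^'n \<Rightarrow> real) set \<Rightarrow> ((real^'n \<Rightarrow> real) \<Rightarrow> real) \<Rightarrow>
     (real^'n \<Rightarrow> real) \<Rightarrow> (real^'n \<Rightarrow> real) \<Rightarrow> real" where
  "frechet_deriv_in \<Omega> K J v = (SOME D. has_frechet_deriv_in \<Omega> K J v D)"

end

(* Writing c = 1 + (delta - 1) v for the scalar weight, both problems have the tensor c C0 with a fixed C0.
   Testing the equations for v and for v + theta only with the two solutions (for the Dirichlet problem, with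
   their differences from the lifting) shows that the energy increment is exactly
   (1/2) int theta (C1 - C0) e(u_v) : e(u_(v+theta)), with a minus sign for the Neumann problem, and by
   coercivity that |e(u_(v+theta)) - e(u_v)| <= const |theta|_infinity in L2. Hence the increment of J differs
   from the claimed derivative by a quadratic remainder, and the variational inequality is the first-order
   condition on the convex set K. This choice of test functions avoids any trace theorem; what is needed about
   Sobolev spaces is the a.e. uniqueness, hence linearity, of weak derivatives. *)

theory Submission
  imports Defs
begin

text \<open>\<open>weak_partial\<close> and \<open>frechet_deriv_in\<close> are values of Hilbert
  choice, and this shapes the proof. The representatives chosen for u, w and u - w are unrelated as
  functions, so nothing linear can be computed with strains or gradients until two weak derivatives
  of one function are known to agree almost everywhere. That is the fundamental lemma of the
  calculus of variations, obtained here from explicit bumps that approach indicators of boxes and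
  from Lebesgue differentiation. Likewise a derivative relative to K is pinned down only along
  directions that stay in K: convexity keeps v + t z in K for t in (0,1], so any two derivatives
  agree on admissible directions as limits from the right. The constant of the quadratic remainder
  has to depend on v alone. Hence the difference of the two strains is measured against the strain
  at v: coercivity, with ellipticity constant min(1, delta) times that of C0, bounds it by the
  perturbation times the norm of e(u_v), uniformly in theta.\<close>

section \<open>Smooth bump functions\<close>

text \<open>The power of \<open>1 / t\<close> makes the family closed under differentiation up to
  linear combinations, so that smoothness becomes one induction with \<open>m\<close> arbitrary. The
  parameter \<open>c\<close> is there to be sent to 0, which turns bumps into indicators.\<close>

definition flat_exp :: "real \<Rightarrow> nat \<Rightarrow> real \<Rightarrow> real" where
  "flat_exp c m t = (if t > 0 then (1 / t) ^ m * exp (- c / t) else 0)"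

lemma flat_exp_tendsto_0:
  assumes "c > 0"
  shows "(flat_exp c m \<longlongrightarrow> 0) (at 0)"
proof -
  have "((\<lambda>x. (x::real) ^ m / exp (c * x)) \<longlongrightarrow> 0) at_top"
  proof -
    have 1: "filterlim (\<lambda>x::real. c * x) at_top at_top"
      by (rule filterlim_tendsto_pos_mult_at_top[OF tendsto_const assms filterlim_ident])
    have "((\<lambda>x. (1/c)^m * ((c * x) ^ m / exp (c * x))) \<longlongrightarrow> (1/c)^m * 0) at_top"
      by (intro tendsto_mult tendsto_const filterlim_compose[OF tendsto_power_div_exp_0 1])
    moreover have "(\<lambda>x. (1/c)^m * ((c * x) ^ m / exp (c * x))) = (\<lambda>x. x ^ m / exp (c * x))"
      using assms by (auto simp: power_mult_distrib power_divide)
    ultimately show ?thesis by simp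
  qed
  \<comment> \<open>The substitution x = 1/t turns flatness at 0 from the right into the domination
    of powers by the exponential at infinity.\<close>
  then have "((\<lambda>t. (inverse t) ^ m / exp (c * inverse t)) \<longlongrightarrow> 0) (at_right 0)"
    by (rule filterlim_compose) (rule filterlim_inverse_at_top_right)
  then have "(flat_exp c m \<longlongrightarrow> 0) (at_right 0)"
    by (rule Lim_transform_eventually)
      (auto simp: flat_exp_def eventually_at_filter exp_minus divide_inverse)
  moreover have "(flat_exp c m \<longlongrightarrow> 0) (at_left 0)"
    by (rule Lim_transform_eventually[OF tendsto_const])
      (auto simp: flat_exp_def eventually_at_filter)
  ultimately show ?thesis
    by (simp add: filterlim_at_split)
qed

lemma flat_exp_has_field_derivative:
  assumes c: "c > 0"
  shows "(flat_exp c m has_field_derivative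
           c * flat_exp c (m + 2) t - real m * flat_exp c (m + 1) t) (at t)"
proof (cases t "0::real" rule: linorder_cases)
  case less
  have "(flat_exp c m has_field_derivative 0) (at t)"
    by (rule has_field_derivative_transform_within_open[of "\<lambda>_. 0" _ _ "{..<0}"])
      (use less in \<open>auto simp: flat_exp_def\<close>)
  then show ?thesis using less by (simp add: flat_exp_def)
next
  case equal
  \<comment> \<open>The difference quotient at 0 is again a member of the family, with
    \<open>m\<close> raised by one. At h = 0 both sides are 0, by division by zero on the
    right.\<close>
  have "flat_exp c (Suc m) = (\<lambda>h. (flat_exp c m (0 + h) - flat_exp c m 0) / h)"
    by (auto simp: flat_exp_def)
  then have "((\<lambda>h. (flat_exp c m (0 + h) - flat_exp c m 0) / h) \<longlongrightarrow> 0) (at 0)"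
    using flat_exp_tendsto_0[OF c, of "Suc m"] by simp
  then show ?thesis unfolding equal DERIV_def by (simp add: flat_exp_def)
next
  case greater
  define s where "s = 1 / t"
  have s: "((\<lambda>t. 1 / t) has_field_derivative - (s\<^sup>2)) (at t)"
    using greater by (auto intro!: derivative_eq_intros simp: s_def power2_eq_square)
  have "((\<lambda>t. (1 / t) ^ m * exp (- c * (1 / t))) has_field_derivative
       real m * (- (s\<^sup>2) * s ^ (m - Suc 0)) * exp (- c * s) + exp (- c * s) * (- c * - (s\<^sup>2)) * s ^ m) (at t)"
    using DERIV_mult[OF DERIV_power[OF s, of m] DERIV_fun_exp[OF DERIV_cmult[OF s, of "- c"]]]
    by (simp only: s_def)
  \<comment> \<open>The truncated exponent \<open>m - Suc 0\<close> does no harm for m = 0, because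
    its factor \<open>real m\<close> vanishes; hence the case split.\<close>
  also have "real m * (- (s\<^sup>2) * s ^ (m - Suc 0)) * exp (- c * s) + exp (- c * s) * (- c * - (s\<^sup>2)) * s ^ m
      = c * (s ^ (m + 2) * exp (- c * s)) - real m * (s ^ (m + 1) * exp (- c * s))"
    by (cases m) (simp_all add: algebra_simps power2_eq_square)
  finally have "((\<lambda>t. (1 / t) ^ m * exp (- c / t)) has_field_derivative
          c * flat_exp c (m + 2) t - real m * flat_exp c (m + 1) t) (at t)"
    using greater by (simp add: flat_exp_def s_def)
  then show ?thesis
    by (rule has_field_derivative_transform_within_open[of _ _ _ "{0<..}"])
      (use greater in \<open>auto simp: flat_exp_def\<close>)
qed

text \<open>The product rule leaves one factor undifferentiated, so \<open>Ck_mult\<close> has to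
  trade one order of regularity for membership in the lower class.\<close>

lemma Ck_SucD: "Ck (Suc k) u \<Longrightarrow> Ck k u"
proof (induction k arbitrary: u)
  case 0
  then show ?case
    by (auto intro!: continuous_at_imp_continuous_on differentiable_imp_continuous_within)
next
  case (Suc k)
  then show ?case by (metis Ck.simps(2))
qed

lemma Ck_const: "Ck k (\<lambda>x. c)"
proof (induction k arbitrary: c)
  case (Suc k)
  then show ?case by (simp add: frechet_derivative_const)
qed simp

lemma Ck_add:
  assumes "Ck k u" "Ck k v" shows "Ck k (\<lambda>x. u x + v x)"
  using assms
proof (induction k arbitrary: u v)
  case 0
  then show ?case by (auto intro: continuous_on_add)
next
  case (Suc k)
  have "frechet_derivative (\<lambda>x. u x + v x) (at x)
      = (\<lambda>b. frechet_derivative u (at x) b + frechet_derivative v (at x) b)" for x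
    using Suc.prems has_derivative_add[of u _ "at x" v]
    by (intro frechet_derivative_at[symmetric]) (simp add: frechet_derivative_works)
  with Suc show ?case by (simp add: differentiable_add)
qed

lemma Ck_mult:
  fixes u v :: "'a::euclidean_space \<Rightarrow> real"
  assumes "Ck k u" "Ck k v" shows "Ck k (\<lambda>x. u x * v x)"
  using assms
proof (induction k arbitrary: u v)
  case 0
  then show ?case by (auto intro: continuous_on_mult)
next
  case (Suc k)
  have "frechet_derivative (\<lambda>x. u x * v x) (at x)
      = (\<lambda>b. u x * frechet_derivative v (at x) b + frechet_derivative u (at x) b * v x)" for x
    using Suc.prems has_derivative_mult[of u _ x UNIV v]
    by (intro frechet_derivative_at[symmetric]) (simp add: frechet_derivative_works)
  with Suc Ck_SucD[of k u] Ck_SucD[of k v] show ?case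
    by (auto simp: differentiable_mult intro!: Ck_add)
qed

lemma Ck_prod:
  fixes u :: "'i \<Rightarrow> 'a::euclidean_space \<Rightarrow> real"
  assumes "\<And>i. i \<in> I \<Longrightarrow> Ck k (u i)" shows "Ck k (\<lambda>x. \<Prod>i\<in>I. u i x)"
  using assms by (induction I rule: infinite_finite_induct) (auto intro: Ck_const Ck_mult)

text \<open>Differentiation replaces \<open>m\<close> by \<open>m + 1\<close> and
  \<open>m + 2\<close>, hence the induction on \<open>k\<close> for all \<open>m\<close>. The affine
  argument covers both faces of a box: the upper one uses \<open>- i\<close> as direction.\<close>

lemma Ck_flat_exp:
  fixes d :: "'a::euclidean_space"
  assumes c: "c > 0"
  shows "Ck k (\<lambda>x. flat_exp c m (x \<bullet> d + a))"
proof (induction k arbitrary: m)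
  case 0
  have "continuous_on UNIV (flat_exp c m)"
    by (rule DERIV_continuous_on) (rule flat_exp_has_field_derivative[OF c])
  then show ?case
    by (auto intro!: continuous_on_compose2[of UNIV "flat_exp c m"] continuous_intros)
next
  case (Suc k)
  have D: "((\<lambda>x. flat_exp c m (x \<bullet> d + a)) has_derivative
       (\<lambda>b. (b \<bullet> d) * (c * flat_exp c (m + 2) (x \<bullet> d + a) - real m * flat_exp c (m + 1) (x \<bullet> d + a)))) (at x)"
    for x
  proof -
    have "((\<lambda>x. x \<bullet> d + a) has_derivative (\<lambda>b. b \<bullet> d)) (at x)"
      by (auto intro!: derivative_eq_intros)
    then show ?thesis
      using flat_exp_has_field_derivative[OF c, of m "x \<bullet> d + a"]
      by (rule DERIV_compose_FDERIV[rotated])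
  qed
  have E: "frechet_derivative (\<lambda>x. flat_exp c m (x \<bullet> d + a)) (at x) b =
       (b \<bullet> d * c) * flat_exp c (m + 2) (x \<bullet> d + a) + (- (b \<bullet> d) * real m) * flat_exp c (m + 1) (x \<bullet> d + a)"
    for x b
    unfolding frechet_derivative_at[OF D, symmetric] by (simp add: algebra_simps)
  have "Ck k (\<lambda>x. frechet_derivative (\<lambda>x. flat_exp c m (x \<bullet> d + a)) (at x) b)" for b
    unfolding E by (intro Ck_add Ck_mult[OF Ck_const] Suc.IH)
  moreover have "(\<lambda>x. flat_exp c m (x \<bullet> d + a)) differentiable (at x)" for x
    using D by (rule differentiableI)
  ultimately show ?case by simp
qed

text \<open>Each factor is positive exactly on one side of a face, so the product is positive
  exactly on the open box.\<close>

definition bump :: "real \<Rightarrow> 'a::euclidean_space \<Rightarrow> 'a \<Rightarrow> 'a \<Rightarrow> real" where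
  "bump c a b x = (\<Prod>i\<in>Basis. flat_exp c 0 (x \<bullet> i - a \<bullet> i) * flat_exp c 0 (b \<bullet> i - x \<bullet> i))"

lemma smooth_bump:
  assumes "c > 0" shows "smooth (bump c a b)"
  unfolding smooth_def
proof
  fix k
  have "Ck k (\<lambda>x. \<Prod>i\<in>Basis. flat_exp c 0 (x \<bullet> i + (- (a \<bullet> i))) * flat_exp c 0 (x \<bullet> (- i) + b \<bullet> i))"
    by (intro Ck_prod Ck_mult Ck_flat_exp assms)
  then show "Ck k (bump c a b)" by (simp add: bump_def[abs_def])
qed

lemma bump_outside: "x \<notin> box a b \<Longrightarrow> bump c a b x = 0"
  unfolding bump_def by (rule prod_zero) (auto simp: box_def flat_exp_def)

lemma bump_test_function:
  assumes "c > 0" "cbox a b \<subseteq> \<Omega>" shows "bump c a b \<in> test_functions \<Omega>"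
  unfolding test_functions_def mem_Collect_eq
proof (intro conjI exI allI impI)
  show "bump c a b x = 0" if "x \<notin> cbox a b" for x
    using that bump_outside box_subset_cbox[of a b] by blast
qed (use assms smooth_bump in auto)

lemma bump_range:
  assumes "c > 0" shows "0 \<le> bump c a b x" "bump c a b x \<le> 1"
proof -
  have "0 \<le> flat_exp c 0 t \<and> flat_exp c 0 t \<le> 1" for t using assms by (auto simp: flat_exp_def)
  then show "0 \<le> bump c a b x" "bump c a b x \<le> 1"
    unfolding bump_def by (auto intro!: prod_nonneg prod_le_1 mult_le_one)
qed

lemma bump_tendsto_indicator:
  "(\<lambda>k. bump (1 / Suc k) a b x) \<longlonglongrightarrow> indicator (box a b) x"
proof (cases "x \<in> box a b")
  case True
  have F: "(\<lambda>k. flat_exp (1 / Suc k) 0 t) \<longlonglongrightarrow> 1" if "t > 0" for t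
  proof -
    have "(\<lambda>k. exp (- (1/t) * (1 / real (Suc k)))) \<longlonglongrightarrow> exp (- (1/t) * 0)"
      by (intro tendsto_intros LIMSEQ_Suc[OF lim_1_over_n])
    then show ?thesis using that by (simp add: flat_exp_def field_simps)
  qed
  have "(\<lambda>k. bump (1 / Suc k) a b x) \<longlonglongrightarrow> (\<Prod>i\<in>(Basis::'a set). 1 * 1)"
    unfolding bump_def using True by (intro tendsto_intros F) (auto simp: box_def)
  then show ?thesis using True by simp
next
  case False
  then show ?thesis by (simp add: bump_outside)
qed

section \<open>The fundamental lemma of the calculus of variations\<close>

lemma continuous_imp_borel_measurable_lebesgue_on:
  fixes \<phi> :: "'a::euclidean_space \<Rightarrow> 'b::euclidean_space"
  assumes "continuous_on UNIV \<phi>"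
  shows "\<phi> \<in> borel_measurable (lebesgue_on S)"
  by (rule measurable_restrict_space1, rule measurable_completion)
    (simp add: borel_measurable_continuous_onI[OF assms])

lemma integrable_lebesgue_on_imp_set_integrable:
  fixes w :: "'a::euclidean_space \<Rightarrow> 'b::euclidean_space"
  assumes "S \<in> sets lebesgue" "integrable (lebesgue_on S) w" "T \<in> sets lebesgue" "T \<subseteq> S"
  shows "set_integrable lebesgue T w"
proof (rule set_integrable_subset)
  show "set_integrable lebesgue S w"
    using assms unfolding set_integrable_def by (simp add: integrable_restrict_space)
qed (use assms in simp_all)

text \<open>Bumps with \<open>c = 1 / Suc k\<close> are test functions between 0 and 1 that converge
  to the indicator of the open box, so \<open>norm (w x)\<close> dominates and the limit of zeros is
  the integral over the box. The result is put in terms of the gauge integral over the closed box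
  because the differentiation theorem applied next speaks of that.\<close>

lemma integral_box_eq_0:
  fixes w :: "'a::euclidean_space \<Rightarrow> 'b::euclidean_space"
  assumes \<Omega>: "open \<Omega>" and w: "integrable (lebesgue_on \<Omega>) w"
    and 0: "\<And>\<phi>. \<phi> \<in> test_functions \<Omega> \<Longrightarrow> (LINT x|lebesgue_on \<Omega>. (\<phi> x :: real) *\<^sub>R w x) = 0"
    and ab: "cbox a b \<subseteq> \<Omega>"
  shows "integral (cbox a b) w = 0"
proof -
  have meas: "bump c a b \<in> borel_measurable (lebesgue_on \<Omega>)" if "c > 0" for c
    using smooth_bump[OF that, of a b] Ck.simps(1)[of "bump c a b"] unfolding smooth_def
    by (intro continuous_imp_borel_measurable_lebesgue_on) simp
  have box: "box a b \<in> sets (lebesgue_on \<Omega>)" "box a b \<subseteq> \<Omega>"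
    using ab box_subset_cbox[of a b] \<Omega> by (auto simp: sets_restrict_space_iff)
  have "(\<lambda>k. LINT x|lebesgue_on \<Omega>. bump (1 / Suc k) a b x *\<^sub>R w x)
      \<longlonglongrightarrow> (LINT x|lebesgue_on \<Omega>. (indicator (box a b) x :: real) *\<^sub>R w x)"
  proof (rule integral_dominated_convergence)
    show "integrable (lebesgue_on \<Omega>) (\<lambda>x. norm (w x))" using w by simp
    show "AE x in lebesgue_on \<Omega>. (\<lambda>k. bump (1 / Suc k) a b x *\<^sub>R w x) \<longlonglongrightarrow> indicator (box a b) x *\<^sub>R w x"
      by (intro AE_I2 tendsto_scaleR bump_tendsto_indicator tendsto_const)
    show "AE x in lebesgue_on \<Omega>. norm (bump (1 / Suc k) a b x *\<^sub>R w x) \<le> norm (w x)" for k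
      using bump_range[of "1 / Suc k" a b] by (auto intro!: mult_left_le_one_le)
    show "(\<lambda>x. (indicator (box a b) x :: real) *\<^sub>R w x) \<in> borel_measurable (lebesgue_on \<Omega>)"
      using box(1) w by (intro borel_measurable_scaleR borel_measurable_indicator) auto
    show "(\<lambda>x. bump (1 / Suc k) a b x *\<^sub>R w x) \<in> borel_measurable (lebesgue_on \<Omega>)" for k
      using w by (intro borel_measurable_scaleR meas) auto
  qed
  then have "(LINT x|lebesgue_on \<Omega>. (indicator (box a b) x :: real) *\<^sub>R w x) = 0"
    using 0[OF bump_test_function[OF _ ab]] by (simp add: LIMSEQ_const_iff)
  then have "(LINT x|lebesgue. (indicator \<Omega> x :: real) *\<^sub>R ((indicator (box a b) x :: real) *\<^sub>R w x)) = 0"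
    using \<Omega> by (subst (asm) integral_restrict_space) auto
  moreover have "indicator \<Omega> x *\<^sub>R (indicator (box a b) x *\<^sub>R w x) = (indicator (box a b) x :: real) *\<^sub>R w x" for x
    using box(2) by (auto simp: indicator_def)
  ultimately have "set_lebesgue_integral lebesgue (box a b) w = 0"
    unfolding set_lebesgue_integral_def by (simp only:)
  moreover have "set_integrable lebesgue (box a b) w"
    by (rule integrable_lebesgue_on_imp_set_integrable[OF _ w]) (use \<Omega> box(2) in simp_all)
  ultimately show ?thesis
    by (simp add: set_lebesgue_integral_eq_integral(2) integral_open_interval)
qed

text \<open>Locally, inside a closed box in the domain, all box averages vanish and Lebesgue
  differentiation forces the function itself to vanish off a null set. An open set is a countable
  union of such boxes, so the null sets add up to a null set.\<close>

lemma fundamental_lemma_calculus_of_variations: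
  fixes w :: "'a::euclidean_space \<Rightarrow> 'b::euclidean_space"
  assumes \<Omega>: "open \<Omega>" and w: "integrable (lebesgue_on \<Omega>) w"
    and 0: "\<And>\<phi>. \<phi> \<in> test_functions \<Omega> \<Longrightarrow> (LINT x|lebesgue_on \<Omega>. (\<phi> x :: real) *\<^sub>R w x) = 0"
  shows "AE x in lebesgue_on \<Omega>. w x = 0"
proof -
  have *: "AE x in lebesgue. x \<in> cbox p q \<longrightarrow> w x = 0" if pq: "cbox p q \<subseteq> \<Omega>" for p q
  proof -
    \<comment> \<open>Cutting off gives a function integrable over every box, as the differentiation
      theorem requires. Its box integrals still vanish, because the intersection of two boxes is a
      box.\<close>
    define f where "f x = (if x \<in> cbox p q then w x else 0)" for x
    have sub: "\<exists>c d. cbox p q \<inter> cbox a b = cbox c d" for a b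
      unfolding Int_interval by blast
    have I: "integral (cbox a b) f = 0" for a b
    proof -
      obtain c d where cd: "cbox p q \<inter> cbox a b = cbox c d" using sub by blast
      then have "cbox c d \<subseteq> \<Omega>" using pq by blast
      from integral_box_eq_0[OF \<Omega> w 0 this] show ?thesis
        by (simp add: f_def[abs_def] Henstock_Kurzweil_Integration.integral_restrict_Int cd)
    qed
    have "f integrable_on cbox a b" for a b
    proof -
      obtain c d where cd: "cbox p q \<inter> cbox a b = cbox c d" using sub by blast
      have "set_integrable lebesgue (cbox c d) w"
        by (rule integrable_lebesgue_on_imp_set_integrable[OF _ w]) (use \<Omega> pq cd in auto)
      then show ?thesis
        by (simp add: f_def[abs_def] integrable_restrict_Int cd set_lebesgue_integral_eq_integral(1))
    qed
    \<comment> \<open>Lebesgue differentiation: off \<open>N\<close>, the averages over cubes with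
      corner \<open>x\<close> and side \<open>h\<close> tend to \<open>f x\<close>.\<close>
    then obtain N where N: "negligible N" "\<And>x e. x \<notin> N \<Longrightarrow> 0 < e \<Longrightarrow>
        \<exists>d>0. \<forall>h. 0 < h \<and> h < d \<longrightarrow>
          norm (integral (cbox x (x + h *\<^sub>R One)) f /\<^sub>R h ^ DIM('a) - f x) < e"
      by (rule integrable_ccontinuous_explicit[of f]) blast+
    have "f x = 0" if xN: "x \<notin> N" for x
    proof (rule ccontr)
      assume "f x \<noteq> 0"
      then obtain d where "d > 0" "\<forall>h. 0 < h \<and> h < d \<longrightarrow>
          norm (integral (cbox x (x + h *\<^sub>R One)) f /\<^sub>R h ^ DIM('a) - f x) < norm (f x)"
        using N(2)[OF xN, of "norm (f x)"] by auto
      \<comment> \<open>With side \<open>d/2\<close> the average is 0, and the estimate would read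
        \<open>norm (f x) < norm (f x)\<close>.\<close>
      then show False using I by (auto dest!: spec[of _ "d/2"])
    qed
    then have "x \<in> N" if "x \<in> cbox p q" "w x \<noteq> 0" for x
      using that unfolding f_def by fastforce
    then have "{x \<in> space lebesgue. \<not> (x \<in> cbox p q \<longrightarrow> w x = 0)} \<subseteq> N" by blast
    then show ?thesis
      using N(1) by (intro AE_I'[of N]) (simp_all add: negligible_iff_null_sets)
  qed
  obtain D where D: "countable D" "D \<subseteq> Pow \<Omega>" "\<And>X. X \<in> D \<Longrightarrow> \<exists>a b. X = cbox a b" "\<Union>D = \<Omega>"
    using open_countable_Union_open_cbox[OF \<Omega>] by metis
  have "AE x in lebesgue. \<forall>X\<in>D. x \<in> X \<longrightarrow> w x = 0"
    unfolding AE_ball_countable[OF D(1)]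
  proof
    fix X assume X: "X \<in> D"
    with D(3) obtain a b where "X = cbox a b" by blast
    with X D(2) show "AE x in lebesgue. x \<in> X \<longrightarrow> w x = 0" using *[of a b] by blast
  qed
  then have "AE x in lebesgue. x \<in> \<Omega> \<longrightarrow> w x = 0"
    by eventually_elim (use D(4) in blast)
  then show ?thesis using \<Omega> by (simp add: AE_restrict_space_iff)
qed

section \<open>Square-integrable functions\<close>

lemma L2_borel_measurable: "u \<in> L2 M \<Longrightarrow> u \<in> borel_measurable M"
  and L2_integrable_norm_square: "u \<in> L2 M \<Longrightarrow> integrable M (\<lambda>x. (norm (u x))\<^sup>2)"
  by (auto simp: L2_def)

lemma L2_integrable_norm_mult:
  assumes "u \<in> L2 M" "w \<in> L2 M"
  shows "integrable M (\<lambda>x. norm (u x) * norm (w x))"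
proof (rule Bochner_Integration.integrable_bound)
  show "integrable M (\<lambda>x. (norm (u x))\<^sup>2 + (norm (w x))\<^sup>2)"
    using assms by (simp add: L2_def)
  show "(\<lambda>x. norm (u x) * norm (w x)) \<in> borel_measurable M"
    using assms by (auto simp: L2_def)
  have "a * b \<le> a\<^sup>2 + b\<^sup>2" for a b :: real
    using sum_squares_bound[of a b] zero_le_power2[of a] zero_le_power2[of b] by linarith
  then show "AE x in M. norm (norm (u x) * norm (w x)) \<le> norm ((norm (u x))\<^sup>2 + (norm (w x))\<^sup>2)"
    by auto
qed

lemma L2_integrable_inner:
  assumes "u \<in> L2 M" "w \<in> L2 M"
  shows "integrable M (\<lambda>x. u x \<bullet> w x)"
  by (rule Bochner_Integration.integrable_bound[OF L2_integrable_norm_mult[OF assms]])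
    (use assms Cauchy_Schwarz_ineq2 in \<open>auto simp: L2_def\<close>)

lemma L2_const: "finite_measure M \<Longrightarrow> (\<lambda>_. c) \<in> L2 M"
  by (auto simp: L2_def finite_measure.integrable_const)

text \<open>Pairing with the constant 1, which is square integrable on a finite measure
  space.\<close>

lemma L2_integrable:
  assumes "finite_measure M" "u \<in> L2 M" shows "integrable M u"
  using L2_integrable_norm_mult[OF assms(2) L2_const[OF assms(1), of "1::real"]] assms(2)
  by (simp add: L2_def integrable_norm_iff)

lemma norm_lincomb_square:
  fixes u w :: "'a::real_inner"
  shows "(norm (a *\<^sub>R u + b *\<^sub>R w))\<^sup>2 = a\<^sup>2 * (norm u)\<^sup>2 + 2 * a * b * (u \<bullet> w) + b\<^sup>2 * (norm w)\<^sup>2"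
  unfolding power2_norm_eq_inner
  by (simp only: inner_add_left inner_add_right inner_scaleR_left
      inner_scaleR_right inner_commute[of w u] distrib_left distrib_right power2_eq_square mult_ac)

lemma L2_lincomb:
  assumes u: "u \<in> L2 M" and w: "w \<in> L2 M"
  shows "(\<lambda>x. a *\<^sub>R u x + b *\<^sub>R w x) \<in> L2 M"
  unfolding L2_def
proof (intro CollectI conjI)
  show m: "(\<lambda>x. a *\<^sub>R u x + b *\<^sub>R w x) \<in> borel_measurable M"
    using u w by (auto simp: L2_def)
  have "integrable M (\<lambda>x. a\<^sup>2 * (norm (u x))\<^sup>2 + 2 * a * b * (u x \<bullet> w x) + b\<^sup>2 * (norm (w x))\<^sup>2)"
    using u w by (intro Bochner_Integration.integrable_add integrable_mult_right
        L2_integrable_inner L2_integrable_norm_square)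
  moreover have "(norm (a *\<^sub>R u x + b *\<^sub>R w x))\<^sup>2
      = a\<^sup>2 * (norm (u x))\<^sup>2 + 2 * a * b * (u x \<bullet> w x) + b\<^sup>2 * (norm (w x))\<^sup>2" for x
    by (rule norm_lincomb_square)
  ultimately show "integrable M (\<lambda>x. (norm (a *\<^sub>R u x + b *\<^sub>R w x))\<^sup>2)" by simp
qed

lemma L2_add: "u \<in> L2 M \<Longrightarrow> w \<in> L2 M \<Longrightarrow> (\<lambda>x. u x + w x) \<in> L2 M"
  and L2_diff: "u \<in> L2 M \<Longrightarrow> w \<in> L2 M \<Longrightarrow> (\<lambda>x. u x - w x) \<in> L2 M"
  using L2_lincomb[of u M w 1 1] L2_lincomb[of u M w 1 "-1"] by simp_all

lemma L2_bounded_linear: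
  assumes "bounded_linear T" "u \<in> L2 M" shows "(\<lambda>x. T (u x)) \<in> L2 M"
proof -
  obtain B where B: "\<And>x. norm (T x) \<le> norm x * B"
    using bounded_linear.bounded[OF assms(1)] by blast
  have m: "(\<lambda>x. T (u x)) \<in> borel_measurable M"
    using assms by (intro borel_measurable_continuous_on[of T] linear_continuous_on L2_borel_measurable)
  have "integrable M (\<lambda>x. (norm (T (u x)))\<^sup>2)"
  proof (rule Bochner_Integration.integrable_bound)
    show "integrable M (\<lambda>x. B\<^sup>2 * (norm (u x))\<^sup>2)" using assms by (simp add: L2_def)
    have "(norm (T y))\<^sup>2 \<le> B\<^sup>2 * (norm y)\<^sup>2" for y
      using power_mono[OF B[of y] norm_ge_zero, of 2] by (simp add: power_mult_distrib mult.commute)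
    then show "AE x in M. norm ((norm (T (u x)))\<^sup>2) \<le> norm (B\<^sup>2 * (norm (u x))\<^sup>2)" by simp
    show "(\<lambda>x. (norm (T (u x)))\<^sup>2) \<in> borel_measurable M" using m by simp
  qed
  with m show ?thesis by (simp add: L2_def)
qed

text \<open>The polynomial t |-> integral of |u + t w|^2 is nonnegative. Its value at the minimum
  gives the inequality; when the leading coefficient vanishes the linear one must vanish
  too.\<close>

lemma Cauchy_Schwarz_integral:
  assumes u: "u \<in> L2 M" and w: "w \<in> L2 M"
  shows "\<bar>LINT x|M. u x \<bullet> w x\<bar> \<le> sqrt (LINT x|M. (norm (u x))\<^sup>2) * sqrt (LINT x|M. (norm (w x))\<^sup>2)"
proof -
  let ?A = "LINT x|M. (norm (u x))\<^sup>2" and ?B = "LINT x|M. u x \<bullet> w x" and ?C = "LINT x|M. (norm (w x))\<^sup>2"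
  have *: "0 \<le> ?A + 2 * t * ?B + t\<^sup>2 * ?C" for t
  proof -
    have "0 \<le> (LINT x|M. (norm (u x + t *\<^sub>R w x))\<^sup>2)" by simp
    also have "\<dots> = (LINT x|M. (norm (u x))\<^sup>2 + 2 * t * (u x \<bullet> w x) + t\<^sup>2 * (norm (w x))\<^sup>2)"
      using norm_lincomb_square[of 1 "u _" t "w _"] by (intro Bochner_Integration.integral_cong refl) simp
    also have "\<dots> = ?A + 2 * t * ?B + t\<^sup>2 * ?C"
      using u w by (simp add: L2_integrable_norm_square L2_integrable_inner)
    finally show ?thesis .
  qed
  have C: "?C \<ge> 0" by simp
  have "?B\<^sup>2 \<le> ?A * ?C"
  proof (cases "?C = 0")
    case True
    have "?B = 0"
    proof (rule ccontr)
      assume "?B \<noteq> 0"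
      \<comment> \<open>At this \<open>t\<close> the affine polynomial takes the value -1.\<close>
      then show False using *[of "- (?A + 1) / (2 * ?B)"] True by (simp add: field_simps)
    qed
    then show ?thesis using True by simp
  next
    case False
    then have "0 < ?C" using C by linarith
    \<comment> \<open>The minimizer of the polynomial.\<close>
    then show ?thesis using *[of "- ?B / ?C"] by (simp add: field_simps power2_eq_square)
  qed
  then have "sqrt (?B\<^sup>2) \<le> sqrt (?A * ?C)" by (rule real_sqrt_le_mono)
  then show ?thesis by (simp only: real_sqrt_abs real_sqrt_mult)
qed

section \<open>Linearity of weak derivatives\<close>

lemma AE_abs_le_Linf_norm:
  assumes "u \<in> Linf M"
  shows "AE x in M. \<bar>u x\<bar> \<le> Linf_norm M u"
  using esssup_AE[of "\<lambda>x. ereal \<bar>u x\<bar>" M]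
proof eventually_elim
  case (elim x)
  \<comment> \<open>Membership in \<open>Linf\<close> excludes infinity, which
    \<open>real_of_ereal\<close> would send to 0; minus infinity contradicts the pointwise
    bound.\<close>
  then show ?case
    using assms by (cases "esssup M (\<lambda>x. ereal \<bar>u x\<bar>)") (auto simp: Linf_def Linf_norm_def)
qed

lemma LinfI:
  assumes "u \<in> borel_measurable M" "AE x in M. \<bar>u x\<bar> \<le> B"
  shows "u \<in> Linf M"
proof -
  have "esssup M (\<lambda>x. ereal \<bar>u x\<bar>) \<le> ereal B"
    using assms by (intro esssup_I) auto
  then show ?thesis using assms(1) by (auto simp: Linf_def)
qed

lemma Linf_borel_measurable: "u \<in> Linf M \<Longrightarrow> u \<in> borel_measurable M"
  by (simp add: Linf_def)

lemma Linf_lincomb: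
  assumes u: "u \<in> Linf M" and w: "w \<in> Linf M"
  shows "(\<lambda>x. a * u x + b * w x) \<in> Linf M"
proof (rule LinfI)
  show "(\<lambda>x. a * u x + b * w x) \<in> borel_measurable M"
    using u w by (auto simp: Linf_def)
  show "AE x in M. \<bar>a * u x + b * w x\<bar> \<le> \<bar>a\<bar> * Linf_norm M u + \<bar>b\<bar> * Linf_norm M w"
    using AE_abs_le_Linf_norm[OF u] AE_abs_le_Linf_norm[OF w]
  proof eventually_elim
    case (elim x)
    have "\<bar>a * u x + b * w x\<bar> \<le> \<bar>a\<bar> * \<bar>u x\<bar> + \<bar>b\<bar> * \<bar>w x\<bar>"
      using abs_triangle_ineq[of "a * u x" "b * w x"] by (simp add: abs_mult)
    with elim show ?case
      by (meson add_mono mult_left_mono abs_ge_zero order_trans)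
  qed
qed

lemma Linf_const: "(\<lambda>_. c) \<in> Linf M"
  by (rule LinfI[of _ _ "\<bar>c\<bar>"]) auto

lemma Linf_norm_nonneg:
  assumes "u \<in> borel_measurable M"
  shows "0 \<le> Linf_norm M u"
proof (cases "emeasure M (space M) = 0")
  \<comment> \<open>On a null space the essential supremum is minus infinity, and its real value is
    0 by convention.\<close>
  case True
  then have "esssup M (\<lambda>x. ereal \<bar>u x\<bar>) = - \<infinity>"
    using assms by (intro esssup_zero_space) auto
  then show ?thesis by (simp add: Linf_norm_def)
next
  case False
  have "0 = esssup M (\<lambda>x. 0 :: ereal)" using esssup_const[OF False] by simp
  also have "\<dots> \<le> esssup M (\<lambda>x. ereal \<bar>u x\<bar>)" by (intro esssup_mono) auto
  finally show ?thesis by (simp add: Linf_norm_def real_of_ereal_pos)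
qed

lemma Linf_norm_cmult:
  assumes "t > 0"
  shows "Linf_norm M (\<lambda>x. t * u x) = t * Linf_norm M u"
  using esssup_cmult[OF assms, of M "\<lambda>x. ereal \<bar>u x\<bar>"] assms
  by (simp add: Linf_norm_def abs_mult)

lemma L2_sum:
  assumes "\<And>i. i \<in> I \<Longrightarrow> u i \<in> L2 M"
  shows "(\<lambda>x. \<Sum>i\<in>I. u i x) \<in> L2 M"
  using assms
proof (induction I rule: infinite_finite_induct)
  case (insert i I)
  then show ?case by (simp add: L2_add)
qed (auto simp: L2_def)

text \<open>The field is the sum of the images of its components under the bounded linear maps
  \<open>axis i\<close>. Applied twice, this handles matrix fields.\<close>

lemma L2_vec:
  fixes u :: "'a \<Rightarrow> ('b::euclidean_space)^'n::finite"
  assumes "\<And>i. (\<lambda>x. u x $ i) \<in> L2 M"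
  shows "u \<in> L2 M"
proof -
  have "bounded_linear (axis i :: 'b \<Rightarrow> 'b^'n)" for i
    by (intro linear_conv_bounded_linear[THEN iffD1] linearI) (auto simp: axis_def vec_eq_iff)
  then have "(\<lambda>x. \<Sum>i\<in>UNIV. axis i (u x $ i)) \<in> L2 M"
    by (intro L2_sum L2_bounded_linear[of "axis _"] assms)
  moreover have "(\<Sum>i\<in>UNIV. axis i (u x $ i)) = u x" for x
    by (simp add: vec_eq_iff axis_def sum.delta)
  ultimately show ?thesis by simp
qed

lemma test_function_Ck: "\<phi> \<in> test_functions \<Omega> \<Longrightarrow> Ck k \<phi>"
  by (simp add: test_functions_def smooth_def)

text \<open>The continuous factor is bounded on the compact closure of the domain, and the other
  factor is integrable since the domain has finite measure. It serves both sides of the weak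
  derivative identity.\<close>

lemma continuous_scaleR_L2_integrable:
  fixes \<phi> :: "'a::euclidean_space \<Rightarrow> real" and u :: "'a \<Rightarrow> 'b::euclidean_space"
  assumes \<Omega>: "open \<Omega>" "bounded \<Omega>" and \<phi>: "continuous_on UNIV \<phi>" and u: "u \<in> L2 (lebesgue_on \<Omega>)"
  shows "integrable (lebesgue_on \<Omega>) (\<lambda>x. \<phi> x *\<^sub>R u x)"
proof -
  have "compact (\<phi> ` closure \<Omega>)"
    using \<Omega> by (intro compact_continuous_image continuous_on_subset[OF \<phi>]) auto
  from compact_imp_bounded[OF this] obtain B where "\<forall>y\<in>\<phi> ` closure \<Omega>. norm y \<le> B"
    unfolding bounded_iff by blast
  then have B: "norm (\<phi> x) \<le> B" if "x \<in> \<Omega>" for x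
    using that closure_subset[of \<Omega>] by blast
  have fm: "finite_measure (lebesgue_on \<Omega>)"
    using \<Omega> by (intro finite_measure_lebesgue_on lmeasurable_open)
  have m: "\<phi> \<in> borel_measurable (lebesgue_on \<Omega>)"
    by (rule continuous_imp_borel_measurable_lebesgue_on[OF \<phi>])
  show ?thesis
  proof (rule Bochner_Integration.integrable_bound)
    show "integrable (lebesgue_on \<Omega>) (\<lambda>x. B *\<^sub>R u x)"
      using L2_integrable[OF fm u] by simp
    show "(\<lambda>x. \<phi> x *\<^sub>R u x) \<in> borel_measurable (lebesgue_on \<Omega>)"
      by (rule borel_measurable_scaleR[OF m L2_borel_measurable[OF u]])
    show "AE x in lebesgue_on \<Omega>. norm (\<phi> x *\<^sub>R u x) \<le> norm (B *\<^sub>R u x)"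
    proof (rule AE_I2)
      fix x assume "x \<in> space (lebesgue_on \<Omega>)"
      then have "\<bar>\<phi> x\<bar> \<le> \<bar>B\<bar>" using B[of x] by simp
      then show "norm (\<phi> x *\<^sub>R u x) \<le> norm (B *\<^sub>R u x)" by (simp add: mult_right_mono)
    qed
  qed
qed

section \<open>Weak derivatives on a bounded open set\<close>

context
  fixes \<Omega> :: "(real^'n::finite) set"
  assumes \<Omega>: "open \<Omega>" "bounded \<Omega>"
begin

lemma finite_measure_domain: "finite_measure (lebesgue_on \<Omega>)"
  using \<Omega> by (intro finite_measure_lebesgue_on lmeasurable_open)

text \<open>The integral is total and gives 0 on nonintegrable functions, so it splits only over
  integrable summands; the four L2 hypotheses supply this.\<close>

lemma has_weak_partial_lincomb:
  fixes u w :: "real^'n \<Rightarrow> 'b::euclidean_space"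
  assumes L2: "u \<in> L2 (lebesgue_on \<Omega>)" "w \<in> L2 (lebesgue_on \<Omega>)" "u' \<in> L2 (lebesgue_on \<Omega>)"
      "w' \<in> L2 (lebesgue_on \<Omega>)"
    and p: "has_weak_partial \<Omega> i u u'" "has_weak_partial \<Omega> i w w'"
  shows "has_weak_partial \<Omega> i (\<lambda>x. a *\<^sub>R u x + b *\<^sub>R w x) (\<lambda>x. a *\<^sub>R u' x + b *\<^sub>R w' x)"
  unfolding has_weak_partial_def
proof
  fix \<phi> :: "real^'n \<Rightarrow> real" assume \<phi>: "\<phi> \<in> test_functions \<Omega>"
  let ?d = "\<lambda>x. frechet_derivative \<phi> (at x) (axis i (1::real))"
  \<comment> \<open>\<open>Ck\<close> controls derivatives along basis vectors only, so the
    direction must be recognized as one of them.\<close>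
  have "axis i (1::real) \<in> (Basis :: (real^'n) set)" by (simp add: axis_in_Basis_iff)
  then have c: "continuous_on UNIV \<phi>" "continuous_on UNIV ?d"
    using test_function_Ck[OF \<phi>, of 0] test_function_Ck[OF \<phi>, of "Suc 0"] by auto
  note I = continuous_scaleR_L2_integrable[OF \<Omega>]
  have *: "(LINT x|lebesgue_on \<Omega>. \<psi> x *\<^sub>R (a *\<^sub>R f x + b *\<^sub>R h x))
      = a *\<^sub>R (LINT x|lebesgue_on \<Omega>. \<psi> x *\<^sub>R f x) + b *\<^sub>R (LINT x|lebesgue_on \<Omega>. \<psi> x *\<^sub>R h x)"
    if "continuous_on UNIV \<psi>" "f \<in> L2 (lebesgue_on \<Omega>)" "h \<in> L2 (lebesgue_on \<Omega>)"
    for \<psi> and f h :: "real^'n \<Rightarrow> 'b"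
  proof -
    have eq: "\<psi> x *\<^sub>R (a *\<^sub>R f x + b *\<^sub>R h x) = a *\<^sub>R (\<psi> x *\<^sub>R f x) + b *\<^sub>R (\<psi> x *\<^sub>R h x)" for x
      by (simp add: scaleR_add_right mult.commute)
    show ?thesis
      unfolding eq using I[OF that(1,2)] I[OF that(1,3)]
      by (subst Bochner_Integration.integral_add) (simp_all del: scaleR_scaleR)
  qed
  have "(LINT x|lebesgue_on \<Omega>. ?d x *\<^sub>R u x) = - (LINT x|lebesgue_on \<Omega>. \<phi> x *\<^sub>R u' x)"
    "(LINT x|lebesgue_on \<Omega>. ?d x *\<^sub>R w x) = - (LINT x|lebesgue_on \<Omega>. \<phi> x *\<^sub>R w' x)"
    using p \<phi> unfolding has_weak_partial_def by blast+
  then show "(LINT x|lebesgue_on \<Omega>. ?d x *\<^sub>R (a *\<^sub>R u x + b *\<^sub>R w x))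
      = - (LINT x|lebesgue_on \<Omega>. \<phi> x *\<^sub>R (a *\<^sub>R u' x + b *\<^sub>R w' x))"
    by (simp only: *[OF c(1) L2(3,4)] *[OF c(2) L2(1,2)] minus_add_distrib scaleR_minus_right)
qed

text \<open>The difference of two weak derivatives integrates to 0 against every test function, so
  the fundamental lemma applies to it.\<close>

lemma has_weak_partial_unique:
  fixes u :: "real^'n \<Rightarrow> 'b::euclidean_space"
  assumes L2: "w \<in> L2 (lebesgue_on \<Omega>)" "w' \<in> L2 (lebesgue_on \<Omega>)"
    and p: "has_weak_partial \<Omega> i u w" "has_weak_partial \<Omega> i u w'"
  shows "AE x in lebesgue_on \<Omega>. w x = w' x"
proof -
  note int = L2_integrable[OF finite_measure_domain]
  have "AE x in lebesgue_on \<Omega>. w x - w' x = 0"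
  proof (rule fundamental_lemma_calculus_of_variations)
    fix \<phi> :: "real^'n \<Rightarrow> real" assume \<phi>: "\<phi> \<in> test_functions \<Omega>"
    have c: "continuous_on UNIV \<phi>" using test_function_Ck[OF \<phi>, of 0] by simp
    have "- (LINT x|lebesgue_on \<Omega>. \<phi> x *\<^sub>R w x) = - (LINT x|lebesgue_on \<Omega>. \<phi> x *\<^sub>R w' x)"
      unfolding p(1)[unfolded has_weak_partial_def, rule_format, OF \<phi>, symmetric]
        p(2)[unfolded has_weak_partial_def, rule_format, OF \<phi>, symmetric] ..
    then show "(LINT x|lebesgue_on \<Omega>. \<phi> x *\<^sub>R (w x - w' x)) = 0"
      using continuous_scaleR_L2_integrable[OF \<Omega> c L2(1)] continuous_scaleR_L2_integrable[OF \<Omega> c L2(2)]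
      by (simp add: scaleR_diff_right)
  qed (use \<Omega> int[OF L2(1)] int[OF L2(2)] in auto)
  then show ?thesis by eventually_elim simp
qed

lemma weak_partial:
  fixes u :: "real^'n \<Rightarrow> 'b::euclidean_space"
  assumes "u \<in> H1 \<Omega>"
  shows weak_partial_L2: "weak_partial \<Omega> i u \<in> L2 (lebesgue_on \<Omega>)"
    and has_weak_partial: "has_weak_partial \<Omega> i u (weak_partial \<Omega> i u)"
proof -
  have "\<exists>w. w \<in> L2 (lebesgue_on \<Omega>) \<and> has_weak_partial \<Omega> i u w"
    using assms by (simp add: H1_def)
  from someI_ex[OF this] show "weak_partial \<Omega> i u \<in> L2 (lebesgue_on \<Omega>)"
    "has_weak_partial \<Omega> i u (weak_partial \<Omega> i u)" by (auto simp: weak_partial_def)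
qed

lemma H1_L2: "u \<in> H1 \<Omega> \<Longrightarrow> u \<in> L2 (lebesgue_on \<Omega>)"
  by (simp add: H1_def)

context
  fixes u w :: "real^'n \<Rightarrow> 'b::euclidean_space"
  assumes u: "u \<in> H1 \<Omega>" and w: "w \<in> H1 \<Omega>"
begin

lemma H1_lincomb: "(\<lambda>x. a *\<^sub>R u x + b *\<^sub>R w x) \<in> H1 \<Omega>"
proof -
  have "has_weak_partial \<Omega> i (\<lambda>x. a *\<^sub>R u x + b *\<^sub>R w x)
      (\<lambda>x. a *\<^sub>R weak_partial \<Omega> i u x + b *\<^sub>R weak_partial \<Omega> i w x)" for i
    by (intro has_weak_partial_lincomb H1_L2 u w weak_partial_L2 has_weak_partial)
  moreover have "(\<lambda>x. a *\<^sub>R weak_partial \<Omega> i u x + b *\<^sub>R weak_partial \<Omega> i w x) \<in> L2 (lebesgue_on \<Omega>)" for i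
    by (intro L2_lincomb u w weak_partial_L2)
  ultimately show ?thesis
    using L2_lincomb[OF H1_L2[OF u] H1_L2[OF w]] unfolding H1_def by blast
qed

text \<open>The right-hand side is a weak derivative of the combination, while the left-hand side is
  the chosen one; uniqueness identifies them, hence only almost everywhere.\<close>

lemma weak_partial_lincomb:
  "AE x in lebesgue_on \<Omega>. weak_partial \<Omega> i (\<lambda>x. a *\<^sub>R u x + b *\<^sub>R w x) x
     = a *\<^sub>R weak_partial \<Omega> i u x + b *\<^sub>R weak_partial \<Omega> i w x"
  by (rule has_weak_partial_unique[OF weak_partial_L2[OF H1_lincomb] _ has_weak_partial[OF H1_lincomb]])
    (intro L2_lincomb has_weak_partial_lincomb H1_L2 u w weak_partial_L2 has_weak_partial)+

end

end

section \<open>Weighted elastic forms\<close>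

lemma sym_part_bounded_linear: "bounded_linear (sym_part :: real^'n^'n \<Rightarrow> real^'n^'n::finite)"
  by (intro linear_conv_bounded_linear[THEN iffD1] linearI)
    (auto simp: sym_part_def transpose_def vec_eq_iff algebra_simps)

lemma tensor_apply_bounded_bilinear:
  "bounded_bilinear (tensor_apply :: real^'n^'n^'n^'n \<Rightarrow> real^'n^'n \<Rightarrow> real^'n^'n::finite)"
  unfolding bilinear_conv_bounded_bilinear[symmetric] bilinear_def
  by (intro conjI allI linearI)
    (simp_all add: tensor_apply_def vec_eq_iff sum.distrib sum_distrib_left algebra_simps)

text \<open>Four transpositions of neighbouring sums exchange the index pair (i,j) with (k,h), and
  the major symmetry of the tensor absorbs the renaming.\<close>

lemma tensor_apply_symmetric:
  fixes C :: "real^'n^'n^'n^'n::finite"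
  assumes "\<And>i j k h. C $ i $ j $ k $ h = C $ k $ h $ i $ j"
  shows "tensor_apply C A \<bullet> B = tensor_apply C B \<bullet> A"
proof -
  let ?T = "\<lambda>i j k h. C $ i $ j $ k $ h * A $ k $ h * B $ i $ j"
  have "tensor_apply C A \<bullet> B = (\<Sum>i\<in>UNIV. \<Sum>j\<in>UNIV. \<Sum>k\<in>UNIV. \<Sum>h\<in>UNIV. ?T i j k h)"
    by (simp add: tensor_apply_def inner_vec_def sum_distrib_right)
  also have "\<dots> = (\<Sum>i\<in>UNIV. \<Sum>k\<in>UNIV. \<Sum>j\<in>UNIV. \<Sum>h\<in>UNIV. ?T i j k h)"
    by (rule sum.cong[OF refl], rule sum.swap)
  also have "\<dots> = (\<Sum>k\<in>UNIV. \<Sum>i\<in>UNIV. \<Sum>j\<in>UNIV. \<Sum>h\<in>UNIV. ?T i j k h)"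
    by (rule sum.swap)
  also have "\<dots> = (\<Sum>k\<in>UNIV. \<Sum>i\<in>UNIV. \<Sum>h\<in>UNIV. \<Sum>j\<in>UNIV. ?T i j k h)"
    by (rule sum.cong[OF refl], rule sum.cong[OF refl], rule sum.swap)
  also have "\<dots> = (\<Sum>k\<in>UNIV. \<Sum>h\<in>UNIV. \<Sum>i\<in>UNIV. \<Sum>j\<in>UNIV. ?T i j k h)"
    by (rule sum.cong[OF refl], rule sum.swap)
  also have "\<dots> = (\<Sum>k\<in>UNIV. \<Sum>h\<in>UNIV. \<Sum>i\<in>UNIV. \<Sum>j\<in>UNIV. C $ k $ h $ i $ j * B $ i $ j * A $ k $ h)"
    using assms by (simp add: mult_ac)
  also have "\<dots> = tensor_apply C B \<bullet> A"
    by (simp add: tensor_apply_def inner_vec_def sum_distrib_right)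
  finally show ?thesis .
qed

text \<open>The quantifiers over matrices stand inside the almost-everywhere statements: one null
  set serves all matrices, so the bounds may be applied to matrix fields such as strains.\<close>

locale bounded_coercive_tensor =
  fixes M :: "'a measure" and C :: "'a \<Rightarrow> real^'n^'n^'n^'n::finite" and \<Lambda> \<xi> :: real
  assumes measurable: "C \<in> borel_measurable M"
    and bound_nonneg: "\<Lambda> \<ge> 0"
    and bound: "AE x in M. \<forall>A B. \<bar>tensor_apply (C x) A \<bullet> B\<bar> \<le> \<Lambda> * (norm A * norm B)"
    and symmetric: "AE x in M. \<forall>A B. tensor_apply (C x) A \<bullet> B = tensor_apply (C x) B \<bullet> A"
    and coercivity_pos: "\<xi> > 0"
    and coercive: "AE x in M. \<forall>A. \<xi> * (norm (sym_part A))\<^sup>2 \<le> tensor_apply (C x) (sym_part A) \<bullet> sym_part A"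
begin

text \<open>One bilinear expression for two purposes: with \<open>weight v\<close> as
  \<open>m\<close> it is the elastic energy form, and with a direction as \<open>m\<close> it is the
  contrast integral up to the factor \<open>\<delta> - 1\<close>.\<close>

definition form :: "('a \<Rightarrow> real) \<Rightarrow> ('a \<Rightarrow> real^'n^'n) \<Rightarrow> ('a \<Rightarrow> real^'n^'n) \<Rightarrow> real" where
  "form m E F = (LINT x|M. m x * (tensor_apply (C x) (E x) \<bullet> F x))"

lemma density_measurable:
  assumes "E \<in> L2 M" "F \<in> L2 M"
  shows "(\<lambda>x. tensor_apply (C x) (E x) \<bullet> F x) \<in> borel_measurable M"
proof (rule borel_measurable_inner)
  have "continuous_on UNIV (\<lambda>x. tensor_apply (fst x) (snd x) :: real^'n^'n)"
    by (intro bounded_bilinear.continuous_on[OF tensor_apply_bounded_bilinear] continuous_intros)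
  from borel_measurable_continuous_Pair[OF measurable L2_borel_measurable[OF assms(1)] this]
  show "(\<lambda>x. tensor_apply (C x) (E x)) \<in> borel_measurable M" .
qed (rule L2_borel_measurable[OF assms(2)])

context
  fixes m :: "'a \<Rightarrow> real" and s :: real
  assumes m: "m \<in> borel_measurable M" and s: "AE x in M. \<bar>m x\<bar> \<le> s"
begin

lemma density_bound:
  "AE x in M. \<bar>m x * (tensor_apply (C x) (E x) \<bullet> F x)\<bar> \<le> s * \<Lambda> * (norm (E x) * norm (F x))"
  using bound s
proof eventually_elim
  case (elim x)
  then have "\<bar>m x\<bar> * \<bar>tensor_apply (C x) (E x) \<bullet> F x\<bar> \<le> s * (\<Lambda> * (norm (E x) * norm (F x)))"
    by (intro mult_mono) auto
  then show ?case by (simp add: abs_mult mult.assoc)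
qed

lemma integrable_form:
  assumes "E \<in> L2 M" "F \<in> L2 M"
  shows "integrable M (\<lambda>x. m x * (tensor_apply (C x) (E x) \<bullet> F x))"
proof (rule Bochner_Integration.integrable_bound)
  show "integrable M (\<lambda>x. s * \<Lambda> * (norm (E x) * norm (F x)))"
    by (intro integrable_mult_right L2_integrable_norm_mult assms)
  show "(\<lambda>x. m x * (tensor_apply (C x) (E x) \<bullet> F x)) \<in> borel_measurable M"
    by (intro borel_measurable_times m density_measurable assms)
  show "AE x in M. norm (m x * (tensor_apply (C x) (E x) \<bullet> F x)) \<le> norm (s * \<Lambda> * (norm (E x) * norm (F x)))"
    using density_bound[of E F] by eventually_elim (simp only: real_norm_def)
qed

text \<open>Hoelder's inequality with exponents infinity, 2, 2: the weight comes out pointwise, and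
  Cauchy-Schwarz is applied to the scalar functions \<open>norm (E x)\<close> and
  \<open>norm (F x)\<close>.\<close>

lemma form_bound:
  assumes "E \<in> L2 M" "F \<in> L2 M" "0 \<le> s"
  shows "\<bar>form m E F\<bar> \<le> s * \<Lambda> * (sqrt (LINT x|M. (norm (E x))\<^sup>2) * sqrt (LINT x|M. (norm (F x))\<^sup>2))"
proof -
  have norm_L2: "(\<lambda>x. norm (G x)) \<in> L2 M" if "G \<in> L2 M" for G :: "'a \<Rightarrow> real^'n^'n"
    using that by (auto simp: L2_def intro: borel_measurable_norm)
  have "\<bar>form m E F\<bar> \<le> (LINT x|M. \<bar>m x * (tensor_apply (C x) (E x) \<bullet> F x)\<bar>)"
    unfolding form_def by (rule integral_abs_bound)
  also have "\<dots> \<le> (LINT x|M. s * \<Lambda> * (norm (E x) * norm (F x)))"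
    by (intro integral_mono_AE integrable_abs integrable_form integrable_mult_right
        L2_integrable_norm_mult density_bound assms)
  also have "\<dots> = s * \<Lambda> * (LINT x|M. norm (E x) * norm (F x))" by simp
  also have "\<dots> \<le> s * \<Lambda> * (sqrt (LINT x|M. (norm (E x))\<^sup>2) * sqrt (LINT x|M. (norm (F x))\<^sup>2))"
    using Cauchy_Schwarz_integral[OF norm_L2[OF assms(1)] norm_L2[OF assms(2)]] assms(3) bound_nonneg
    by (intro mult_left_mono mult_nonneg_nonneg) simp_all
  finally show ?thesis .
qed

lemma form_diff_right:
  assumes "E \<in> L2 M" "F \<in> L2 M" "G \<in> L2 M"
  shows "form m E (\<lambda>x. F x - G x) = form m E F - form m E G"
  unfolding form_def
  using integrable_form[OF assms(1,2)] integrable_form[OF assms(1,3)]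
  by (simp add: inner_diff_right right_diff_distrib)

lemma form_commute: "E \<in> L2 M \<Longrightarrow> F \<in> L2 M \<Longrightarrow> form m E F = form m F E"
  unfolding form_def using symmetric
  by (intro integral_cong_AE borel_measurable_times m density_measurable) auto

end

lemma form_Linf_lincomb:
  assumes "m \<in> Linf M" "k \<in> Linf M" "E \<in> L2 M" "F \<in> L2 M"
  shows "form (\<lambda>x. a * m x + b * k x) E F = a * form m E F + b * form k E F"
proof -
  note I = integrable_form[OF Linf_borel_measurable AE_abs_le_Linf_norm _ _]
  have "(a * m x + b * k x) * t = a * (m x * t) + b * (k x * t)" for x t
    by (simp add: algebra_simps)
  then show ?thesis
    unfolding form_def using I[OF assms(1,1,3,4)] I[OF assms(2,2,3,4)] by simp
qed

text \<open>The tensor is coercive on symmetric parts only, so the field must be given as pointwise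
  symmetric parts of some field \<open>A\<close>.\<close>

lemma form_coercive:
  assumes m: "m \<in> Linf M" "AE x in M. m0 \<le> m x" "0 \<le> m0"
    and E: "E \<in> L2 M" "\<And>x. E x = sym_part (A x)"
  shows "m0 * \<xi> * (LINT x|M. (norm (E x))\<^sup>2) \<le> form m E E"
proof -
  have "m0 * \<xi> * (LINT x|M. (norm (E x))\<^sup>2) = (LINT x|M. m0 * \<xi> * (norm (E x))\<^sup>2)" by simp
  also have "\<dots> \<le> form m E E"
    unfolding form_def
  proof (rule integral_mono_AE)
    show "AE x in M. m0 * \<xi> * (norm (E x))\<^sup>2 \<le> m x * (tensor_apply (C x) (E x) \<bullet> E x)"
      using m(2) coercive
    proof eventually_elim
      case (elim x)
      then have "m0 * (\<xi> * (norm (E x))\<^sup>2) \<le> m x * (tensor_apply (C x) (E x) \<bullet> E x)"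
        using coercivity_pos m(3) E(2)[of x] by (intro mult_mono) auto
      then show ?case by (simp add: mult.assoc)
    qed
  qed (use E(1) m(1) in \<open>auto intro!: L2_integrable_norm_square
      integrable_form[OF Linf_borel_measurable AE_abs_le_Linf_norm]\<close>)
  finally show ?thesis .
qed

text \<open>\<open>E\<close> and \<open>F\<close> are the strains of the solutions for the weights \<open>b\<close> and \<open>b + k z\<close>. Testing both
  equations with the difference gives the hypothesis \<open>eq\<close>, whence \<open>F - E = O(z)\<close> in \<open>L\<^sup>2\<close>, and replacing
  \<open>F\<close> by \<open>E\<close> in the exact increment costs only a quadratic error.\<close>

lemma linearization_error:
  assumes b: "b \<in> Linf M" and z: "z \<in> Linf M"
    and m0: "AE x in M. m0 \<le> b x + k * z x" "0 < m0"
    and E: "E \<in> L2 M" "\<And>x. E x = sym_part (A x)"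
    and F: "F \<in> L2 M" "\<And>x. F x = sym_part (B x)"
    and eq: "form (\<lambda>x. b x + k * z x) F F - form (\<lambda>x. b x + k * z x) F E = form b E F - form b E E"
  shows "\<bar>form z E F - form z E E\<bar>
      \<le> \<bar>k\<bar> * \<Lambda>\<^sup>2 / (m0 * \<xi>) * (LINT x|M. (norm (E x))\<^sup>2) * (Linf_norm M z)\<^sup>2"
proof -
  let ?b' = "\<lambda>x. b x + k * z x"
  define D where "D x = F x - E x" for x
  define X where "X = sqrt (LINT x|M. (norm (E x))\<^sup>2)"
  define Y where "Y = sqrt (LINT x|M. (norm (D x))\<^sup>2)"
  define s where "s = Linf_norm M z"
  define c where "c = m0 * \<xi>"
  have D: "D \<in> L2 M" unfolding D_def by (rule L2_diff[OF F(1) E(1)])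
  \<comment> \<open>The difference is again a field of symmetric parts, so coercivity is available
    for it.\<close>
  have Ds: "D x = sym_part (B x - A x)" for x
    by (simp add: D_def E(2) F(2) linear_simps(2)[OF sym_part_bounded_linear])
  have b': "?b' \<in> Linf M" using Linf_lincomb[OF b z, of 1 k] by simp
  note L = Linf_borel_measurable AE_abs_le_Linf_norm
  have diff: "form m G D = form m G F - form m G E" if "m \<in> Linf M" "G \<in> L2 M" for m G
    unfolding D_def by (intro form_diff_right[OF L] that E F)
  have split: "form ?b' E D = form b E D + k * form z E D"
    using form_Linf_lincomb[OF b z E(1) D, of 1 k] by simp
  have "form ?b' D D = form ?b' F D - form ?b' E D"
    using diff[OF b' D] form_commute[OF L(1)[OF b'] L(2)[OF b'] D E(1)]
      form_commute[OF L(1)[OF b'] L(2)[OF b'] D F(1)] by simp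
  \<comment> \<open>The hypothesis \<open>eq\<close> says that the new form at (F,D) equals the old
    one at (E,D). Only the perturbation of the weight at (E,D) survives.\<close>
  also have "\<dots> = - (k * form z E D)"
    using diff[OF b' F(1)] diff[OF b E(1)] eq split by simp
  finally have "form ?b' D D = - (k * form z E D)" .
  moreover have "c * Y\<^sup>2 \<le> form ?b' D D"
    using form_coercive[OF b' m0(1) _ D Ds] m0(2) by (simp add: c_def Y_def)
  moreover have s0: "0 \<le> s" unfolding s_def by (rule Linf_norm_nonneg[OF L(1)[OF z]])
  have zED: "\<bar>form z E D\<bar> \<le> s * \<Lambda> * (X * Y)"
    unfolding X_def Y_def s_def by (rule form_bound[OF L(1)[OF z] L(2)[OF z] E(1) D s0[unfolded s_def]])
  ultimately have "c * Y\<^sup>2 \<le> \<bar>k\<bar> * (s * \<Lambda> * (X * Y))"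
    using mult_left_mono[OF zED, of "\<bar>k\<bar>"] by (simp add: abs_mult[symmetric])
  \<comment> \<open>The quadratic inequality is divided by \<open>Y\<close>; for
    \<open>Y = 0\<close> it suffices that the right-hand side is nonnegative.\<close>
  then have cY: "c * Y \<le> \<bar>k\<bar> * s * \<Lambda> * X"
  proof (cases "Y = 0")
    case True
    then show ?thesis using s0 bound_nonneg by (simp add: X_def)
  next
    case False
    then have "Y > 0" by (simp add: Y_def less_le)
    moreover have "(c * Y) * Y \<le> (\<bar>k\<bar> * s * \<Lambda> * X) * Y"
      using \<open>c * Y\<^sup>2 \<le> \<bar>k\<bar> * (s * \<Lambda> * (X * Y))\<close> by (simp only: power2_eq_square mult.assoc)
    ultimately show ?thesis by (rule mult_right_le_imp_le[rotated])
  qed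
  have c: "c > 0" using m0(2) coercivity_pos by (simp add: c_def)
  have "\<bar>form z E F - form z E E\<bar> = \<bar>form z E D\<bar>" using diff[OF z E(1)] by simp
  \<comment> \<open>The factor \<open>c / c\<close> is inserted so that \<open>cY\<close> can be
    used a second time as a bound; this produces the square of \<open>s\<close> and the constant of
    the statement.\<close>
  also have "\<dots> \<le> s * \<Lambda> * X * (c * Y) / c" using zED c by (simp add: mult_ac)
  also have "\<dots> \<le> s * \<Lambda> * X * (\<bar>k\<bar> * s * \<Lambda> * X) / c"
    using s0 bound_nonneg c by (intro divide_right_mono mult_left_mono[OF cY]) (simp_all add: X_def)
  also have "\<dots> = \<bar>k\<bar> * \<Lambda>\<^sup>2 / c * X\<^sup>2 * s\<^sup>2" by (simp add: power2_eq_square)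
  finally show ?thesis by (simp add: X_def s_def c_def)
qed

end

lemma elasticity_tensor_bounded_coercive:
  fixes C :: "real^'n \<Rightarrow> real^'n^'n^'n^'n::finite"
  assumes "\<xi> > 0" "elasticity_tensor \<Omega> \<xi> C"
  obtains \<Lambda> where "bounded_coercive_tensor (lebesgue_on \<Omega>) C \<Lambda> \<xi>"
proof -
  obtain K where K: "K \<ge> 0" "\<And>(C::real^'n^'n^'n^'n) A. norm (tensor_apply C A) \<le> norm C * norm A * K"
    using bounded_bilinear.nonneg_bounded[OF tensor_apply_bounded_bilinear] by blast
  obtain B where B: "AE x in lebesgue_on \<Omega>. norm (C x) \<le> B"
    using assms(2) unfolding elasticity_tensor_def by blast
  \<comment> \<open>The bound is that of the bilinear map \<open>tensor_apply\<close> times the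
    essential bound of the tensor; the absolute value is taken because \<open>B\<close> is obtained
    without a sign.\<close>
  have "bounded_coercive_tensor (lebesgue_on \<Omega>) C (\<bar>B\<bar> * K) \<xi>"
  proof
    show "AE x in lebesgue_on \<Omega>. \<forall>A A'. \<bar>tensor_apply (C x) A \<bullet> A'\<bar> \<le> \<bar>B\<bar> * K * (norm A * norm A')"
      using B
    proof (eventually_elim, intro allI)
      fix x and A A' :: "real^'n^'n" assume "norm (C x) \<le> B"
      then have "norm (C x) * norm A * K \<le> \<bar>B\<bar> * norm A * K"
        using K(1) by (intro mult_right_mono) auto
      with K(2)[of "C x" A] have "norm (tensor_apply (C x) A) \<le> \<bar>B\<bar> * norm A * K" by linarith
      then have "norm (tensor_apply (C x) A) * norm A' \<le> \<bar>B\<bar> * norm A * K * norm A'"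
        by (rule mult_right_mono) simp
      with Cauchy_Schwarz_ineq2[of "tensor_apply (C x) A" A']
      show "\<bar>tensor_apply (C x) A \<bullet> A'\<bar> \<le> \<bar>B\<bar> * K * (norm A * norm A')" by (simp add: mult_ac)
    qed
    have "AE x in lebesgue_on \<Omega>. \<forall>i j k h.
        C x $ i $ j $ k $ h = C x $ j $ i $ k $ h \<and> C x $ i $ j $ k $ h = C x $ k $ h $ i $ j"
      using assms(2) unfolding elasticity_tensor_def by blast
    then show "AE x in lebesgue_on \<Omega>. \<forall>A B. tensor_apply (C x) A \<bullet> B = tensor_apply (C x) B \<bullet> A"
      by eventually_elim (intro allI tensor_apply_symmetric, blast)
  qed (use assms K(1) in \<open>auto simp: elasticity_tensor_def\<close>)
  then show thesis by (rule that)
qed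

section \<open>Directional derivatives on convex sets of phase functions\<close>

lemma power2_norm_vec_eq_sum: "(norm (x :: ('b::real_inner)^'n::finite))\<^sup>2 = (\<Sum>i\<in>UNIV. (norm (x $ i))\<^sup>2)"
  by (simp only: power2_norm_eq_inner inner_vec_def)

lemma H1_norm_nonneg: "0 \<le> H1_norm \<Omega> u"
  by (simp add: H1_norm_def sum_nonneg)

context
  fixes \<Omega> :: "(real^'n::finite) set"
  assumes \<Omega>: "open \<Omega>" "bounded \<Omega>"
begin

lemma strain_L2:
  assumes "u \<in> H1 \<Omega>" shows "strain \<Omega> u \<in> L2 (lebesgue_on \<Omega>)"
proof -
  have "bounded_linear (\<lambda>v :: real^'n. v $ i)" for i by (rule bounded_linear_vec_nth)
  then have "(\<lambda>x. weak_partial \<Omega> j u x $ i) \<in> L2 (lebesgue_on \<Omega>)" for i j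
    using weak_partial_L2[OF \<Omega> assms] by (rule L2_bounded_linear)
  then have "weak_jacobian \<Omega> u \<in> L2 (lebesgue_on \<Omega>)"
    by (intro L2_vec) (simp add: weak_jacobian_def)
  from L2_bounded_linear[OF sym_part_bounded_linear this] show ?thesis
    by (simp add: strain_def[abs_def])
qed

text \<open>Needed because the admissible test function in the Dirichlet problem is a solution minus
  the lifting, whose strain is built from its own chosen derivatives.\<close>

lemma strain_diff:
  assumes u: "u \<in> H1 \<Omega>" and w: "w \<in> H1 \<Omega>"
  shows "AE x in lebesgue_on \<Omega>. strain \<Omega> (\<lambda>x. u x - w x) x = strain \<Omega> u x - strain \<Omega> w x"
proof -
  have "AE x in lebesgue_on \<Omega>. \<forall>i\<in>UNIV. weak_partial \<Omega> i (\<lambda>x. u x - w x) x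
      = weak_partial \<Omega> i u x - weak_partial \<Omega> i w x"
    using weak_partial_lincomb[OF \<Omega> u w, of _ 1 "-1"] by (intro AE_finite_allI) auto
  then show ?thesis
  proof eventually_elim
    case (elim x)
    then have "weak_jacobian \<Omega> (\<lambda>x. u x - w x) x = weak_jacobian \<Omega> u x - weak_jacobian \<Omega> w x"
      by (simp add: weak_jacobian_def vec_eq_iff)
    then show ?case by (simp add: strain_def linear_simps(2)[OF sym_part_bounded_linear])
  qed
qed

lemma weak_grad_L2: "v \<in> H1 \<Omega> \<Longrightarrow> weak_grad \<Omega> v \<in> L2 (lebesgue_on \<Omega>)"
  by (intro L2_vec) (simp add: weak_grad_def weak_partial_L2[OF \<Omega>])

lemma weak_grad_lincomb:
  assumes u: "u \<in> H1 \<Omega>" and w: "w \<in> H1 \<Omega>"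
  shows "AE x in lebesgue_on \<Omega>. weak_grad \<Omega> (\<lambda>x. a * u x + b * w x) x
      = a *\<^sub>R weak_grad \<Omega> u x + b *\<^sub>R weak_grad \<Omega> w x"
proof -
  have "AE x in lebesgue_on \<Omega>. \<forall>i\<in>UNIV. weak_partial \<Omega> i (\<lambda>x. a * u x + b * w x) x
      = a * weak_partial \<Omega> i u x + b * weak_partial \<Omega> i w x"
    using weak_partial_lincomb[OF \<Omega> u w, of _ a b] by (intro AE_finite_allI) auto
  then show ?thesis
    by eventually_elim (simp add: weak_grad_def vec_eq_iff)
qed

lemma H1_lincomb_real: "u \<in> H1 \<Omega> \<Longrightarrow> w \<in> H1 \<Omega> \<Longrightarrow> (\<lambda>x. a * u x + b * w x :: real) \<in> H1 \<Omega>"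
  using H1_lincomb[OF \<Omega>, of u w a b] by simp

lemma H1_norm_square:
  assumes "v \<in> H1 \<Omega>"
  shows "(H1_norm \<Omega> v)\<^sup>2 = (LINT x|lebesgue_on \<Omega>. (v x)\<^sup>2) + (LINT x|lebesgue_on \<Omega>. (norm (weak_grad \<Omega> v x))\<^sup>2)"
proof -
  have "(LINT x|lebesgue_on \<Omega>. (norm (weak_grad \<Omega> v x))\<^sup>2)
      = (\<Sum>i\<in>UNIV. LINT x|lebesgue_on \<Omega>. (norm (weak_partial \<Omega> i v x))\<^sup>2)"
    unfolding power2_norm_vec_eq_sum weak_grad_def
    by (simp add: L2_integrable_norm_square[OF weak_partial_L2[OF \<Omega> assms], simplified])
  then show ?thesis by (simp add: H1_norm_def sum_nonneg)
qed

text \<open>The weak partials of \<open>t * v\<close> are chosen independently of those of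
  \<open>v\<close>, so homogeneity of the norm also passes through almost-everywhere
  linearity.\<close>

lemma H1_norm_cmult:
  assumes v: "v \<in> H1 \<Omega>" and t: "0 \<le> t"
  shows "H1_norm \<Omega> (\<lambda>x. t * v x) = t * H1_norm \<Omega> v"
proof -
  have tv: "(\<lambda>x. t * v x) \<in> H1 \<Omega>" using H1_lincomb_real[OF v v, of t 0] by simp
  have "(LINT x|lebesgue_on \<Omega>. (norm (weak_grad \<Omega> (\<lambda>x. t * v x) x))\<^sup>2)
      = (LINT x|lebesgue_on \<Omega>. t\<^sup>2 * (norm (weak_grad \<Omega> v x))\<^sup>2)"
  proof (rule integral_cong_AE)
    show "AE x in lebesgue_on \<Omega>. (norm (weak_grad \<Omega> (\<lambda>x. t * v x) x))\<^sup>2 = t\<^sup>2 * (norm (weak_grad \<Omega> v x))\<^sup>2"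
      using weak_grad_lincomb[OF v v, of t 0] by eventually_elim (simp add: power_mult_distrib)
  qed (use weak_grad_L2[OF v] weak_grad_L2[OF tv] in \<open>auto dest!: L2_integrable_norm_square\<close>)
  then have "(H1_norm \<Omega> (\<lambda>x. t * v x))\<^sup>2 = (t * H1_norm \<Omega> v)\<^sup>2"
    unfolding H1_norm_square[OF tv] power_mult_distrib H1_norm_square[OF v]
    by (simp add: distrib_left)
  then show ?thesis
    using t by (simp add: H1_norm_nonneg)
qed

lemma X_norm_cmult:
  assumes "z \<in> X_space \<Omega>" "t > 0"
  shows "X_norm \<Omega> (\<lambda>x. t * z x) = t * X_norm \<Omega> z"
  using assms by (simp add: X_norm_def X_space_def H1_norm_cmult Linf_norm_cmult distrib_left)

lemma X_norm_bounds:
  assumes "z \<in> X_space \<Omega>"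
  shows "0 \<le> Linf_norm (lebesgue_on \<Omega>) z" "Linf_norm (lebesgue_on \<Omega>) z \<le> X_norm \<Omega> z"
    "H1_norm \<Omega> z \<le> X_norm \<Omega> z" "0 \<le> X_norm \<Omega> z"
  using assms Linf_norm_nonneg[of z "lebesgue_on \<Omega>"] H1_norm_nonneg[of \<Omega> z]
  by (auto simp: X_norm_def X_space_def Linf_def)

text \<open>The limit is one-sided, since only positive multiples of the direction are assumed
  admissible. It serves both to identify the chosen derivative and to read off its sign at a
  minimizer.\<close>

lemma has_frechet_deriv_in_imp_directional:
  assumes D: "has_frechet_deriv_in \<Omega> K J v D" and z: "z \<in> X_space \<Omega>"
    and adm: "\<And>t. 0 < t \<Longrightarrow> t \<le> 1 \<Longrightarrow> (\<lambda>x. t * z x) \<in> admissible_directions K v"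
  shows "((\<lambda>t. (J (\<lambda>x. v x + t * z x) - J v) / t) \<longlongrightarrow> D z) (at_right 0)"
proof (rule tendstoI)
  fix e :: real assume e: "e > 0"
  let ?X = "X_norm \<Omega> z"
  have X: "?X \<ge> 0" by (rule X_norm_bounds(4)[OF z])
  have hom: "D (\<lambda>x. t * z x) = t * D z" for t
  proof -
    have "D (\<lambda>x. t * z x + 0 * z x) = t * D z + 0 * D z"
      using D z unfolding has_frechet_deriv_in_def by blast
    then show ?thesis by simp
  qed
  \<comment> \<open>The added 1 keeps the quotient defined when \<open>?X = 0\<close> and makes
    \<open>e * ?X / (?X + 1) < e\<close> strict.\<close>
  have "e / (?X + 1) > 0" using e X by simp
  then obtain r where r: "r > 0" "\<And>y. y \<in> admissible_directions K v \<Longrightarrow> X_norm \<Omega> y < r \<Longrightarrow>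
      \<bar>J (\<lambda>x. v x + y x) - J v - D y\<bar> \<le> e / (?X + 1) * X_norm \<Omega> y"
    using D unfolding has_frechet_deriv_in_def by blast
  \<comment> \<open>The bound 1 keeps the step admissible, the other one brings its norm below
    \<open>r\<close>.\<close>
  have "eventually (\<lambda>t. t < min 1 (r / (?X + 1))) (at_right 0)"
    using r(1) X by (intro eventually_at_right_less[THEN eventually_mono] order_tendstoD(2)[OF tendsto_ident_at]) auto
  moreover have "eventually (\<lambda>t::real. 0 < t) (at_right 0)" by (rule eventually_at_right_less)
  ultimately show "\<forall>\<^sub>F t in at_right 0. dist ((J (\<lambda>x. v x + t * z x) - J v) / t) (D z) < e"
  proof eventually_elim
    case (elim t)
    have "t * ?X \<le> t * (?X + 1)" using elim by simp
    also have "\<dots> < r" using elim X by (simp add: pos_less_divide_eq)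
    finally have "t * ?X < r" .
    then have "\<bar>J (\<lambda>x. v x + t * z x) - J v - t * D z\<bar> \<le> e / (?X + 1) * (t * ?X)"
      using r(2)[OF adm[of t]] elim by (simp add: X_norm_cmult[OF z] hom)
    also have "\<dots> = t * (e * ?X / (?X + 1))" by simp
    also have "\<dots> < t * e" using elim e X by (intro mult_strict_left_mono) (simp_all add: field_simps)
    finally have "\<bar>J (\<lambda>x. v x + t * z x) - J v - t * D z\<bar> / t < e"
      using elim by (simp add: pos_divide_less_eq mult.commute)
    moreover have "(J (\<lambda>x. v x + t * z x) - J v) / t - D z = (J (\<lambda>x. v x + t * z x) - J v - t * D z) / t"
      using elim by (simp add: field_simps)
    ultimately show ?case using elim by (simp add: dist_real_def abs_divide)
  qed
qed

section \<open>The convex set of phase functions and its admissible directions\<close>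

lemma K_set_convex:
  assumes v: "v \<in> K_set \<Omega> d" and w: "w \<in> K_set \<Omega> d" and t: "0 \<le> t" "t \<le> 1"
  shows "(\<lambda>x. (1 - t) * v x + t * w x) \<in> K_set \<Omega> d"
proof -
  have "AE x in lebesgue_on \<Omega>. 0 \<le> v x \<and> v x \<le> 1" "AE x in lebesgue_on \<Omega>. 0 \<le> w x \<and> w x \<le> 1"
    using v w by (auto simp: K_set_def)
  then have "AE x in lebesgue_on \<Omega>. 0 \<le> (1 - t) * v x + t * w x \<and> (1 - t) * v x + t * w x \<le> 1"
  proof eventually_elim
    case (elim x)
    then show ?case
      using t convex_bound_le[of "v x" 1 "w x" "1 - t" t] by simp
  qed
  moreover have "AE x in lebesgue_on \<Omega>. x \<in> boundary_layer \<Omega> d \<longrightarrow> v x = 0"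
    "AE x in lebesgue_on \<Omega>. x \<in> boundary_layer \<Omega> d \<longrightarrow> w x = 0"
    using v w by (simp_all add: K_set_def)
  then have "AE x in lebesgue_on \<Omega>. x \<in> boundary_layer \<Omega> d \<longrightarrow> (1 - t) * v x + t * w x = 0"
    by eventually_elim simp
  ultimately show ?thesis
    using v w by (simp add: K_set_def H1_lincomb_real)
qed

lemma K_set_subset: "K_set \<Omega> d \<subseteq> X_space \<Omega> \<inter> phase_functions \<Omega>"
proof
  fix v assume v: "v \<in> K_set \<Omega> d"
  then have m: "v \<in> H1 \<Omega>" "v \<in> borel_measurable (lebesgue_on \<Omega>)"
    "AE x in lebesgue_on \<Omega>. 0 \<le> v x \<and> v x \<le> 1"
    by (auto simp: K_set_def H1_def L2_def)
  from m(3) have "AE x in lebesgue_on \<Omega>. \<bar>v x\<bar> \<le> 1" by eventually_elim simp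
  with m show "v \<in> X_space \<Omega> \<inter> phase_functions \<Omega>"
    by (auto simp: X_space_def phase_functions_def intro: LinfI)
qed

text \<open>A direction is the difference of two members of K, and its multiples point to the
  segment between them.\<close>

lemma admissible_direction_K_set:
  assumes v: "v \<in> K_set \<Omega> d" and z: "z \<in> admissible_directions (K_set \<Omega> d) v"
  shows "z \<in> X_space \<Omega>"
    and "0 < t \<Longrightarrow> t \<le> 1 \<Longrightarrow> (\<lambda>x. t * z x) \<in> admissible_directions (K_set \<Omega> d) v"
proof -
  let ?w = "\<lambda>x. z x + v x"
  have w: "?w \<in> K_set \<Omega> d" using z by (simp add: admissible_directions_def)
  have "(\<lambda>x. 1 * ?w x + (-1) * v x) \<in> X_space \<Omega>"
    using v w K_set_subset[of d] Linf_lincomb[of ?w "lebesgue_on \<Omega>" v 1 "-1"] H1_lincomb_real[of ?w v 1 "-1"]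
    unfolding X_space_def by blast
  then show "z \<in> X_space \<Omega>" by simp
  assume t: "0 < t" "t \<le> 1"
  have "(\<lambda>x. (1 - t) * v x + t * ?w x) \<in> K_set \<Omega> d" using K_set_convex[OF v w] t by simp
  moreover have "(\<lambda>x. (1 - t) * v x + t * ?w x) = (\<lambda>x. t * z x + v x)" by (simp add: fun_eq_iff algebra_simps)
  ultimately show "(\<lambda>x. t * z x) \<in> admissible_directions (K_set \<Omega> d) v"
    by (simp add: admissible_directions_def)
qed

end

section \<open>The phase-field functional\<close>

locale phase_field = bounded_coercive_tensor "lebesgue_on \<Omega>" C0 \<Lambda> \<xi>
  for \<Omega> :: "(real^'n::finite) set" and C0 :: "real^'n \<Rightarrow> real^'n^'n^'n^'n" and \<Lambda> \<xi> :: real +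
  fixes \<Sigma>N \<Sigma>D :: "(real^'n) set" and g f uf :: "real^'n \<Rightarrow> real^'n"
    and uN uD :: "(real^'n \<Rightarrow> real) \<Rightarrow> real^'n \<Rightarrow> real^'n" and \<gamma> \<delta> \<epsilon> :: real
  assumes \<Omega>: "open \<Omega>" "bounded \<Omega>"
    and \<delta>: "\<delta> > 0"
    and uf: "uf \<in> H1 \<Omega>"
    and uN: "v \<in> phase_functions \<Omega> \<Longrightarrow> neumann_solution \<Omega> \<Sigma>N \<Sigma>D g (C_delta C0 \<delta> v) (uN v)"
    and uD: "v \<in> phase_functions \<Omega> \<Longrightarrow> dirichlet_solution \<Omega> uf (C_delta C0 \<delta> v) (uD v)"
begin

abbreviation "\<mu> \<equiv> lebesgue_on \<Omega>"

definition weight :: "(real^'n \<Rightarrow> real) \<Rightarrow> real^'n \<Rightarrow> real" where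
  "weight v x = 1 + (\<delta> - 1) * v x"

lemma weight_Linf:
  assumes "v \<in> Linf \<mu>" shows "weight v \<in> Linf \<mu>"
proof -
  have "(\<lambda>x. 1 * 1 + (\<delta> - 1) * v x) \<in> Linf \<mu>" by (rule Linf_lincomb[OF Linf_const assms])
  then show ?thesis by (simp add: weight_def[abs_def])
qed

lemma weight_add: "weight (\<lambda>x. v x + z x) = (\<lambda>x. weight v x + (\<delta> - 1) * z x)"
  by (simp add: weight_def fun_eq_iff algebra_simps)

text \<open>The weight is a convex combination of 1 and \<delta>. The bound is positive whether
  \<delta> lies below or above 1.\<close>

lemma weight_lower_bound:
  assumes "v \<in> phase_functions \<Omega>"
  shows "AE x in \<mu>. min 1 \<delta> \<le> weight v x"
proof -
  have "AE x in \<mu>. 0 \<le> v x \<and> v x \<le> 1" using assms by (simp add: phase_functions_def)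
  then show ?thesis
  proof eventually_elim
    case (elim x)
    have "weight v x = (1 - v x) * 1 + v x * \<delta>" by (simp add: weight_def algebra_simps)
    moreover have "(1 - v x) * min 1 \<delta> + v x * min 1 \<delta> \<le> (1 - v x) * 1 + v x * \<delta>"
      using elim by (intro add_mono mult_left_mono) auto
    ultimately show ?case by (simp add: algebra_simps)
  qed
qed

lemma tensor_apply_scaleR: "tensor_apply (c *\<^sub>R C) A = c *\<^sub>R tensor_apply C A"
  by (rule bounded_bilinear.scaleR_left[OF tensor_apply_bounded_bilinear])

lemma elastic_form_eq:
  "elastic_form \<Omega> (C_delta C0 \<delta> v) u w = form (weight v) (strain \<Omega> u) (strain \<Omega> w)"
proof -
  have "C_delta C0 \<delta> v x = weight v x *\<^sub>R C0 x" for x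
    by (simp add: C_delta_def weight_def algebra_simps)
  then show ?thesis by (simp add: elastic_form_def form_def tensor_apply_scaleR)
qed

lemma contrast_form_eq:
  "(LINT x|\<mu>. \<theta> x * (tensor_apply (\<delta> *\<^sub>R C0 x - C0 x) (E x) \<bullet> E x)) = (\<delta> - 1) * form \<theta> E E"
proof -
  have "\<delta> *\<^sub>R C0 x - C0 x = (\<delta> - 1) *\<^sub>R C0 x" for x by (simp add: algebra_simps)
  then have "(LINT x|\<mu>. \<theta> x * (tensor_apply (\<delta> *\<^sub>R C0 x - C0 x) (E x) \<bullet> E x))
      = (LINT x|\<mu>. (\<delta> - 1) * (\<theta> x * (tensor_apply (C0 x) (E x) \<bullet> E x)))"
    by (simp add: tensor_apply_scaleR mult_ac)
  then show ?thesis by (simp add: form_def)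
qed

definition eN :: "(real^'n \<Rightarrow> real) \<Rightarrow> real^'n \<Rightarrow> real^'n^'n" where "eN v = strain \<Omega> (uN v)"
definition eD :: "(real^'n \<Rightarrow> real) \<Rightarrow> real^'n \<Rightarrow> real^'n^'n" where "eD v = strain \<Omega> (uD v)"

lemma uN_H1: "v \<in> phase_functions \<Omega> \<Longrightarrow> uN v \<in> H1 \<Omega>"
  using uN by (auto simp: neumann_solution_def H1_vanishing_on_def)

lemma uD_H1: "v \<in> phase_functions \<Omega> \<Longrightarrow> uD v \<in> H1 \<Omega>"
  using uD by (auto simp: dirichlet_solution_def)

lemma eN_L2: "v \<in> phase_functions \<Omega> \<Longrightarrow> eN v \<in> L2 \<mu>"
  and eD_L2: "v \<in> phase_functions \<Omega> \<Longrightarrow> eD v \<in> L2 \<mu>"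
  unfolding eN_def eD_def by (simp_all add: strain_L2[OF \<Omega>] uN_H1 uD_H1)

text \<open>Kept in the shape of the theorem, so that the final identification is an unfolding. The
  estimates use \<open>dJ_eq\<close>, where the contrast is pulled out as the scalar
  \<open>\<delta> - 1\<close>.\<close>

definition dJ :: "(real^'n \<Rightarrow> real) \<Rightarrow> (real^'n \<Rightarrow> real) \<Rightarrow> real" where
  "dJ v \<theta> = 1/2 * (LINT x|\<mu>. \<theta> x * (tensor_apply (\<delta> *\<^sub>R C0 x - C0 x) (strain \<Omega> (uD v) x) \<bullet> strain \<Omega> (uD v) x))
     - 1/2 * (LINT x|\<mu>. \<theta> x * (tensor_apply (\<delta> *\<^sub>R C0 x - C0 x) (strain \<Omega> (uN v) x) \<bullet> strain \<Omega> (uN v) x))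
     + 2 * \<gamma> * \<epsilon> * (LINT x|\<mu>. weak_grad \<Omega> v x \<bullet> weak_grad \<Omega> \<theta> x)
     + \<gamma> / \<epsilon> * (LINT x|\<mu>. (1 - 2 * v x) * \<theta> x)"

abbreviation "J \<equiv> J_func \<Omega> \<Sigma>N C0 g f uN uD \<gamma> \<delta> \<epsilon>"

lemma dJ_eq:
  "dJ v \<theta> = (\<delta> - 1) / 2 * form \<theta> (eD v) (eD v) - (\<delta> - 1) / 2 * form \<theta> (eN v) (eN v)
     + 2 * \<gamma> * \<epsilon> * (LINT x|\<mu>. weak_grad \<Omega> v x \<bullet> weak_grad \<Omega> \<theta> x)
     + \<gamma> / \<epsilon> * (LINT x|\<mu>. (1 - 2 * v x) * \<theta> x)"
  unfolding dJ_def contrast_form_eq eN_def eD_def by simp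

lemma L2_one_minus_double: "v \<in> H1 \<Omega> \<Longrightarrow> (\<lambda>x. 1 - 2 * v x) \<in> L2 \<mu>" for v :: "real^'n \<Rightarrow> real"
  using L2_lincomb[OF L2_const[OF finite_measure_domain[OF \<Omega>], of 1] H1_L2[OF \<Omega>], of v 1 "-2"] by simp

section \<open>The increment of the functional between two phase functions\<close>

context
  fixes v z :: "real^'n \<Rightarrow> real"
  assumes v: "v \<in> phase_functions \<Omega>" "v \<in> X_space \<Omega>" and z: "z \<in> X_space \<Omega>"
    and vz: "(\<lambda>x. v x + z x) \<in> phase_functions \<Omega>"
begin

lemma Linf_facts: "v \<in> Linf \<mu>" "z \<in> Linf \<mu>" "(\<lambda>x. v x + z x) \<in> Linf \<mu>"
  using v(2) z Linf_lincomb[of v \<mu> z 1 1] by (auto simp: X_space_def)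

lemma form_weight_add:
  assumes "E \<in> L2 \<mu>" "F \<in> L2 \<mu>"
  shows "form (weight (\<lambda>x. v x + z x)) E F = form (weight v) E F + (\<delta> - 1) * form z E F"
  using form_Linf_lincomb[OF weight_Linf[OF Linf_facts(1)] Linf_facts(2) assms, of 1 "\<delta> - 1"]
  by (simp add: weight_add)

lemma form_weight_commute:
  assumes "E \<in> L2 \<mu>" "F \<in> L2 \<mu>" "w \<in> Linf \<mu>"
  shows "form w E F = form w F E"
  by (rule form_commute[OF Linf_borel_measurable AE_abs_le_Linf_norm]) (use assms in simp_all)

text \<open>The instance with base weight \<open>weight v\<close>, factor
  \<open>k = \<delta> - 1\<close> and \<open>m0 = min 1 \<delta>\<close>. Coercivity is used for the
  weight of the perturbed function, hence the appeal to \<open>vz\<close>.\<close>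

lemma linearization_error_strain:
  assumes "u \<in> H1 \<Omega>" "w \<in> H1 \<Omega>"
    and "form (weight (\<lambda>x. v x + z x)) (strain \<Omega> w) (strain \<Omega> w) - form (weight (\<lambda>x. v x + z x)) (strain \<Omega> w) (strain \<Omega> u)
      = form (weight v) (strain \<Omega> u) (strain \<Omega> w) - form (weight v) (strain \<Omega> u) (strain \<Omega> u)"
  shows "\<bar>form z (strain \<Omega> u) (strain \<Omega> w) - form z (strain \<Omega> u) (strain \<Omega> u)\<bar>
      \<le> \<bar>\<delta> - 1\<bar> * \<Lambda>\<^sup>2 / (min 1 \<delta> * \<xi>) * (LINT x|\<mu>. (norm (strain \<Omega> u x))\<^sup>2) * (Linf_norm \<mu> z)\<^sup>2"
proof (rule linearization_error)
  show "AE x in \<mu>. min 1 \<delta> \<le> weight v x + (\<delta> - 1) * z x"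
    using weight_lower_bound[OF vz] by (simp add: weight_add)
  show "form (\<lambda>x. weight v x + (\<delta> - 1) * z x) (strain \<Omega> w) (strain \<Omega> w)
      - form (\<lambda>x. weight v x + (\<delta> - 1) * z x) (strain \<Omega> w) (strain \<Omega> u)
      = form (weight v) (strain \<Omega> u) (strain \<Omega> w) - form (weight v) (strain \<Omega> u) (strain \<Omega> u)"
    using assms(3) by (simp add: weight_add)
  show "strain \<Omega> u x = sym_part (weak_jacobian \<Omega> u x)" "strain \<Omega> w x = sym_part (weak_jacobian \<Omega> w x)" for x
    by (simp_all add: strain_def)
qed (use assms \<delta> Linf_facts in \<open>simp_all add: weight_Linf strain_L2[OF \<Omega>]\<close>)

text \<open>Write l for the load. Testing crosswise, the energy at v + z is l(u_(v+z)), which is the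
  old form at the two solutions, and the energy at v is l(u_v), which is the new form at them. The
  difference is thus old minus new, whence the sign. The same four values verify the hypothesis of
  \<open>linearization_error_strain\<close>.\<close>

lemma neumann_increment:
  shows "form (weight (\<lambda>x. v x + z x)) (eN (\<lambda>x. v x + z x)) (eN (\<lambda>x. v x + z x)) - form (weight v) (eN v) (eN v)
      = - ((\<delta> - 1) * form z (eN v) (eN (\<lambda>x. v x + z x)))" (is "?lhs = ?rhs")
    and "\<bar>form z (eN v) (eN (\<lambda>x. v x + z x)) - form z (eN v) (eN v)\<bar>
      \<le> \<bar>\<delta> - 1\<bar> * \<Lambda>\<^sup>2 / (min 1 \<delta> * \<xi>) * (LINT x|\<mu>. (norm (eN v x))\<^sup>2) * (Linf_norm \<mu> z)\<^sup>2"
proof -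
  let ?w = "\<lambda>x. v x + z x"
  let ?l = "\<lambda>\<phi>. LINT x|surface_on \<Sigma>N. g x \<bullet> bdry_trace \<Omega> \<phi> x"
  have mem: "uN v \<in> H1_vanishing_on \<Omega> \<Sigma>D" "uN ?w \<in> H1_vanishing_on \<Omega> \<Sigma>D"
    using uN[OF v(1)] uN[OF vz] by (auto simp: neumann_solution_def)
  have 1: "form (weight v) (eN v) (strain \<Omega> \<phi>) = ?l \<phi>" "form (weight ?w) (eN ?w) (strain \<Omega> \<phi>) = ?l \<phi>"
    if "\<phi> \<in> H1_vanishing_on \<Omega> \<Sigma>D" for \<phi>
    using uN[OF v(1)] uN[OF vz] that by (auto simp: neumann_solution_def eN_def elastic_form_eq)
  note eqs = 1[OF mem(1), folded eN_def] 1[OF mem(2), folded eN_def]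
  show "\<bar>form z (eN v) (eN ?w) - form z (eN v) (eN v)\<bar>
      \<le> \<bar>\<delta> - 1\<bar> * \<Lambda>\<^sup>2 / (min 1 \<delta> * \<xi>) * (LINT x|\<mu>. (norm (eN v x))\<^sup>2) * (Linf_norm \<mu> z)\<^sup>2"
    using linearization_error_strain[OF uN_H1[OF v(1)] uN_H1[OF vz], folded eN_def] eqs by simp
  have "form (weight ?w) (eN ?w) (eN v) = form (weight v) (eN v) (eN ?w) + (\<delta> - 1) * form z (eN v) (eN ?w)"
    using form_weight_commute[OF eN_L2[OF vz] eN_L2[OF v(1)] weight_Linf[OF Linf_facts(3)]]
      form_weight_add[OF eN_L2[OF v(1)] eN_L2[OF vz]] by simp
  then show "?lhs = ?rhs" using eqs by simp
qed

text \<open>With zero load and common boundary data, either energy is unchanged when its second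
  argument is replaced by the other solution. The difference is thus new form minus old form at the
  two solutions, opposite to the Neumann case.\<close>

lemma dirichlet_increment:
  shows "form (weight (\<lambda>x. v x + z x)) (eD (\<lambda>x. v x + z x)) (eD (\<lambda>x. v x + z x)) - form (weight v) (eD v) (eD v)
      = (\<delta> - 1) * form z (eD v) (eD (\<lambda>x. v x + z x))" (is "?lhs = ?rhs")
    and "\<bar>form z (eD v) (eD (\<lambda>x. v x + z x)) - form z (eD v) (eD v)\<bar>
      \<le> \<bar>\<delta> - 1\<bar> * \<Lambda>\<^sup>2 / (min 1 \<delta> * \<xi>) * (LINT x|\<mu>. (norm (eD v x))\<^sup>2) * (Linf_norm \<mu> z)\<^sup>2"
proof -
  let ?w = "\<lambda>x. v x + z x"
  \<comment> \<open>In the second slot any solution may be replaced by the lifting, because their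
    difference is a test function. Both solutions therefore give the same value.\<close>
  have test: "form m E (eD y) = form m E (strain \<Omega> uf)"
    if y: "y \<in> phase_functions \<Omega>" and m: "m \<in> Linf \<mu>" and E: "E \<in> L2 \<mu>"
      and sol: "\<And>\<psi>. \<psi> \<in> H1_0 \<Omega> \<Longrightarrow> form m E (strain \<Omega> \<psi>) = 0" for m E y
  proof -
    have mem: "(\<lambda>x. uD y x - uf x) \<in> H1_0 \<Omega>" using uD[OF y] by (simp add: dirichlet_solution_def)
    then have H1: "(\<lambda>x. uD y x - uf x) \<in> H1 \<Omega>" by (simp add: H1_0_def)
    have "form m E (strain \<Omega> (\<lambda>x. uD y x - uf x)) = 0" by (rule sol[OF mem])
    moreover have "form m E (strain \<Omega> (\<lambda>x. uD y x - uf x)) = form m E (\<lambda>x. eD y x - strain \<Omega> uf x)"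
      unfolding form_def
    proof (rule integral_cong_AE)
      show "AE x in \<mu>. m x * (tensor_apply (C0 x) (E x) \<bullet> strain \<Omega> (\<lambda>x. uD y x - uf x) x)
          = m x * (tensor_apply (C0 x) (E x) \<bullet> (eD y x - strain \<Omega> uf x))"
        using strain_diff[OF \<Omega> uD_H1[OF y] uf] by eventually_elim (simp add: eD_def)
    qed (intro borel_measurable_times Linf_borel_measurable[OF m] density_measurable E
        strain_L2[OF \<Omega> H1] L2_diff eD_L2[OF y] strain_L2[OF \<Omega> uf])+
    moreover have "form m E (\<lambda>x. eD y x - strain \<Omega> uf x) = form m E (eD y) - form m E (strain \<Omega> uf)"
      by (rule form_diff_right[OF Linf_borel_measurable[OF m] AE_abs_le_Linf_norm[OF m] E eD_L2[OF y] strain_L2[OF \<Omega> uf]])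
    ultimately show ?thesis by simp
  qed
  have sol: "form (weight v) (eD v) (strain \<Omega> \<psi>) = 0" "form (weight ?w) (eD ?w) (strain \<Omega> \<psi>) = 0"
    if "\<psi> \<in> H1_0 \<Omega>" for \<psi>
    using uD[OF v(1)] uD[OF vz] that by (auto simp: dirichlet_solution_def eD_def elastic_form_eq)
  note W = weight_Linf[OF Linf_facts(1)] weight_Linf[OF Linf_facts(3)]
  note eqs = test[OF v(1) W(1) eD_L2[OF v(1)] sol(1)] test[OF vz W(1) eD_L2[OF v(1)] sol(1)]
    test[OF v(1) W(2) eD_L2[OF vz] sol(2)] test[OF vz W(2) eD_L2[OF vz] sol(2)]
  show "\<bar>form z (eD v) (eD ?w) - form z (eD v) (eD v)\<bar>
      \<le> \<bar>\<delta> - 1\<bar> * \<Lambda>\<^sup>2 / (min 1 \<delta> * \<xi>) * (LINT x|\<mu>. (norm (eD v x))\<^sup>2) * (Linf_norm \<mu> z)\<^sup>2"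
    using linearization_error_strain[OF uD_H1[OF v(1)] uD_H1[OF vz], folded eD_def] eqs by simp
  have "form (weight ?w) (eD ?w) (eD v) = form (weight v) (eD v) (eD ?w) + (\<delta> - 1) * form z (eD v) (eD ?w)"
    using form_weight_commute[OF eD_L2[OF vz] eD_L2[OF v(1)] W(2)]
      form_weight_add[OF eD_L2[OF v(1)] eD_L2[OF vz]] by simp
  then show "?lhs = ?rhs" using eqs by simp
qed

text \<open>Exact, because the integrand is quadratic in the function and its gradient. The
  concavity of v(1 - v) gives the last term its minus sign.\<close>

lemma perimeter_increment:
  "(LINT x|\<mu>. \<epsilon> * (norm (weak_grad \<Omega> (\<lambda>x. v x + z x) x))\<^sup>2 + 1/\<epsilon> * ((v x + z x) * (1 - (v x + z x))))
    - (LINT x|\<mu>. \<epsilon> * (norm (weak_grad \<Omega> v x))\<^sup>2 + 1/\<epsilon> * (v x * (1 - v x)))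
    = 2 * \<epsilon> * (LINT x|\<mu>. weak_grad \<Omega> v x \<bullet> weak_grad \<Omega> z x) + 1/\<epsilon> * (LINT x|\<mu>. (1 - 2 * v x) * z x)
      + \<epsilon> * (LINT x|\<mu>. (norm (weak_grad \<Omega> z x))\<^sup>2) - 1/\<epsilon> * (LINT x|\<mu>. (z x)\<^sup>2)"
proof -
  let ?G = "weak_grad \<Omega>"
  have H: "v \<in> H1 \<Omega>" "z \<in> H1 \<Omega>" using v(2) z by (auto simp: X_space_def)
  have Hw: "(\<lambda>x. v x + z x) \<in> H1 \<Omega>" using H1_lincomb_real[OF \<Omega> H, of 1 1] by simp
  note G = weak_grad_L2[OF \<Omega> H(1)] weak_grad_L2[OF \<Omega> H(2)] weak_grad_L2[OF \<Omega> Hw]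
  note L = H1_L2[OF \<Omega> H(1)] H1_L2[OF \<Omega> H(2)] H1_L2[OF \<Omega> Hw]
  have one: "(\<lambda>_. 1) \<in> L2 \<mu>" by (rule L2_const[OF finite_measure_domain[OF \<Omega>]])
  from L2_integrable_inner[OF L2_one_minus_double[OF H(1)] L(2)] have i1: "integrable \<mu> (\<lambda>x. (1 - 2 * v x) * z x)" by simp
  have "(\<lambda>x. 1 - v x) \<in> L2 \<mu>" using L2_diff[OF one L(1)] by simp
  from L2_integrable_inner[OF L(1) this] have i2: "integrable \<mu> (\<lambda>x. v x * (1 - v x))" by simp
  have i3: "integrable \<mu> (\<lambda>x. (z x)\<^sup>2)" using L2_integrable_norm_square[OF L(2)] by simp
  note i = i1 i2 i3 L2_integrable_norm_square[OF G(1)] L2_integrable_norm_square[OF G(2)]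
    L2_integrable_inner[OF G(1,2)]
  have m: "(\<lambda>x. v x + z x) \<in> borel_measurable \<mu>" "?G (\<lambda>x. v x + z x) \<in> borel_measurable \<mu>"
    "v \<in> borel_measurable \<mu>" "z \<in> borel_measurable \<mu>" "?G v \<in> borel_measurable \<mu>" "?G z \<in> borel_measurable \<mu>"
    using L2_borel_measurable G L by blast+
  have "(LINT x|\<mu>. \<epsilon> * (norm (?G (\<lambda>x. v x + z x) x))\<^sup>2 + 1/\<epsilon> * ((v x + z x) * (1 - (v x + z x))))
    = (LINT x|\<mu>. (\<epsilon> * (norm (?G v x))\<^sup>2 + 1/\<epsilon> * (v x * (1 - v x))) + 2 * \<epsilon> * (?G v x \<bullet> ?G z x)
      + 1/\<epsilon> * ((1 - 2 * v x) * z x) + \<epsilon> * (norm (?G z x))\<^sup>2 - 1/\<epsilon> * (z x)\<^sup>2)"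
  proof (rule integral_cong_AE)
    show "AE x in \<mu>. \<epsilon> * (norm (?G (\<lambda>x. v x + z x) x))\<^sup>2 + 1/\<epsilon> * ((v x + z x) * (1 - (v x + z x)))
      = (\<epsilon> * (norm (?G v x))\<^sup>2 + 1/\<epsilon> * (v x * (1 - v x))) + 2 * \<epsilon> * (?G v x \<bullet> ?G z x)
      + 1/\<epsilon> * ((1 - 2 * v x) * z x) + \<epsilon> * (norm (?G z x))\<^sup>2 - 1/\<epsilon> * (z x)\<^sup>2"
      using weak_grad_lincomb[OF \<Omega> H, of 1 1]
    proof eventually_elim
      case (elim x)
      have "(norm (?G (\<lambda>x. v x + z x) x))\<^sup>2 = (norm (?G v x))\<^sup>2 + 2 * (?G v x \<bullet> ?G z x) + (norm (?G z x))\<^sup>2"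
        using elim norm_lincomb_square[of 1 "?G v x" 1 "?G z x"] by simp
      moreover have "(v x + z x) * (1 - (v x + z x)) = v x * (1 - v x) + (1 - 2 * v x) * z x - (z x)\<^sup>2"
        by (simp add: power2_eq_square algebra_simps)
      ultimately show ?case by (simp add: algebra_simps diff_divide_distrib add_divide_distrib)
    qed
  qed (use m in measurable)
  also have "\<dots> = (LINT x|\<mu>. \<epsilon> * (norm (?G v x))\<^sup>2 + 1/\<epsilon> * (v x * (1 - v x)))
      + 2 * \<epsilon> * (LINT x|\<mu>. ?G v x \<bullet> ?G z x) + 1/\<epsilon> * (LINT x|\<mu>. (1 - 2 * v x) * z x)
      + \<epsilon> * (LINT x|\<mu>. (norm (?G z x))\<^sup>2) - 1/\<epsilon> * (LINT x|\<mu>. (z x)\<^sup>2)"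
    using i by simp
  finally show ?thesis by simp
qed

text \<open>Only second-order contributions remain: the two strain errors and the quadratic terms of
  the perimeter part. Both strain errors are measured by the solution at v, so the factor does not
  depend on z; this uniformity is what yields differentiability.\<close>

lemma J_remainder:
  "\<bar>J (\<lambda>x. v x + z x) - J v - dJ v z\<bar>
    \<le> (\<bar>\<delta> - 1\<bar> / 2 * (\<bar>\<delta> - 1\<bar> * \<Lambda>\<^sup>2 / (min 1 \<delta> * \<xi>)) *
        ((LINT x|\<mu>. (norm (eN v x))\<^sup>2) + (LINT x|\<mu>. (norm (eD v x))\<^sup>2)) + \<bar>\<gamma>\<bar> * (\<bar>\<epsilon>\<bar> + \<bar>1/\<epsilon>\<bar>)) * (X_norm \<Omega> z)\<^sup>2"
proof -
  let ?w = "\<lambda>x. v x + z x"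
  let ?s = "Linf_norm \<mu> z" and ?X = "X_norm \<Omega> z"
  let ?q = "\<bar>\<delta> - 1\<bar> * \<Lambda>\<^sup>2 / (min 1 \<delta> * \<xi>)"
  let ?cN = "LINT x|\<mu>. (norm (eN v x))\<^sup>2" and ?cD = "LINT x|\<mu>. (norm (eD v x))\<^sup>2"
  define rN where "rN = form z (eN v) (eN ?w) - form z (eN v) (eN v)"
  define rD where "rD = form z (eD v) (eD ?w) - form z (eD v) (eD v)"
  define a where "a = (LINT x|\<mu>. (norm (weak_grad \<Omega> z x))\<^sup>2)"
  define b where "b = (LINT x|\<mu>. (z x)\<^sup>2)"
  have ab: "0 \<le> a" "0 \<le> b" by (simp_all add: a_def b_def)
  have "J ?w - J v = 1/2 * (form (weight ?w) (eN ?w) (eN ?w) - form (weight v) (eN v) (eN v))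
      + 1/2 * (form (weight ?w) (eD ?w) (eD ?w) - form (weight v) (eD v) (eD v))
      + \<gamma> * ((LINT x|\<mu>. \<epsilon> * (norm (weak_grad \<Omega> ?w x))\<^sup>2 + 1/\<epsilon> * ((v x + z x) * (1 - (v x + z x))))
         - (LINT x|\<mu>. \<epsilon> * (norm (weak_grad \<Omega> v x))\<^sup>2 + 1/\<epsilon> * (v x * (1 - v x))))"
    unfolding J_func_def elastic_form_eq eN_def[symmetric] eD_def[symmetric] by (simp only: algebra_simps)
  also have "\<dots> = dJ v z + (- (\<delta> - 1) / 2 * rN + (\<delta> - 1) / 2 * rD + \<gamma> * (\<epsilon> * a - 1/\<epsilon> * b))"
    unfolding neumann_increment(1) dirichlet_increment(1) perimeter_increment dJ_eq rN_def rD_def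
      a_def[symmetric] b_def[symmetric]
    by (simp add: field_simps)
  finally have "\<bar>J ?w - J v - dJ v z\<bar> = \<bar>- (\<delta> - 1) / 2 * rN + (\<delta> - 1) / 2 * rD + \<gamma> * (\<epsilon> * a - 1/\<epsilon> * b)\<bar>"
    by simp
  also have "\<dots> \<le> \<bar>- (\<delta> - 1) / 2 * rN\<bar> + \<bar>(\<delta> - 1) / 2 * rD\<bar> + \<bar>\<gamma> * (\<epsilon> * a - 1/\<epsilon> * b)\<bar>"
    by linarith
  also have "\<dots> = \<bar>\<delta> - 1\<bar> / 2 * \<bar>rN\<bar> + \<bar>\<delta> - 1\<bar> / 2 * \<bar>rD\<bar> + \<bar>\<gamma>\<bar> * \<bar>\<epsilon> * a - 1/\<epsilon> * b\<bar>"
    by (simp add: abs_mult abs_minus_commute)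
  also have "\<dots> \<le> \<bar>\<delta> - 1\<bar> / 2 * (?q * ?cN * ?X\<^sup>2) + \<bar>\<delta> - 1\<bar> / 2 * (?q * ?cD * ?X\<^sup>2)
      + \<bar>\<gamma>\<bar> * ((\<bar>\<epsilon>\<bar> + \<bar>1/\<epsilon>\<bar>) * ?X\<^sup>2)"
  proof (intro add_mono mult_left_mono)
    have s: "?s\<^sup>2 \<le> ?X\<^sup>2" using X_norm_bounds[OF \<Omega> z] by (intro power_mono) auto
    have q: "0 \<le> ?q" using \<delta> coercivity_pos by simp
    show "\<bar>rN\<bar> \<le> ?q * ?cN * ?X\<^sup>2"
      unfolding rN_def
      by (rule order_trans[OF neumann_increment(2)], intro mult_left_mono s mult_nonneg_nonneg q) simp
    show "\<bar>rD\<bar> \<le> ?q * ?cD * ?X\<^sup>2"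
      unfolding rD_def
      by (rule order_trans[OF dirichlet_increment(2)], intro mult_left_mono s mult_nonneg_nonneg q) simp
    \<comment> \<open>The gradient term and the potential term together make up the squared H1 norm,
      so each is bounded by the squared norm of the intersection space.\<close>
    have "a + b = (H1_norm \<Omega> z)\<^sup>2" using z H1_norm_square[OF \<Omega>, of z] by (simp add: a_def b_def X_space_def)
    also have "\<dots> \<le> ?X\<^sup>2" using X_norm_bounds[OF \<Omega> z] by (intro power_mono H1_norm_nonneg)
    finally have abX: "a \<le> ?X\<^sup>2" "b \<le> ?X\<^sup>2" using ab by linarith+
    have "\<bar>\<epsilon> * a - 1/\<epsilon> * b\<bar> \<le> \<bar>\<epsilon>\<bar> * a + \<bar>1/\<epsilon>\<bar> * b"
      using abs_triangle_ineq4[of "\<epsilon> * a" "1/\<epsilon> * b"] ab by (simp add: abs_mult)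
    also have "\<dots> \<le> \<bar>\<epsilon>\<bar> * ?X\<^sup>2 + \<bar>1/\<epsilon>\<bar> * ?X\<^sup>2"
      using abX by (intro add_mono mult_left_mono) auto
    finally show "\<bar>\<epsilon> * a - 1/\<epsilon> * b\<bar> \<le> (\<bar>\<epsilon>\<bar> + \<bar>1/\<epsilon>\<bar>) * ?X\<^sup>2" by (simp only: distrib_right)
  qed simp_all
  finally show ?thesis by (simp only: algebra_simps)
qed

end

section \<open>Linearity and boundedness of the candidate derivative\<close>

lemma dJ_lincomb:
  assumes "v \<in> phase_functions \<Omega>" "v \<in> X_space \<Omega>" "z \<in> X_space \<Omega>" "w \<in> X_space \<Omega>"
  shows "dJ v (\<lambda>x. a * z x + b * w x) = a * dJ v z + b * dJ v w"
proof -
  have v: "v \<in> H1 \<Omega>" and z: "z \<in> Linf \<mu>" "z \<in> H1 \<Omega>" and w: "w \<in> Linf \<mu>" "w \<in> H1 \<Omega>"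
    using assms by (auto simp: X_space_def)
  note G = weak_grad_L2[OF \<Omega> v] weak_grad_L2[OF \<Omega> z(2)] weak_grad_L2[OF \<Omega> w(2)]
    weak_grad_L2[OF \<Omega> H1_lincomb_real[OF \<Omega> z(2) w(2)], of a b]
  have "(LINT x|\<mu>. weak_grad \<Omega> v x \<bullet> weak_grad \<Omega> (\<lambda>x. a * z x + b * w x) x)
    = (LINT x|\<mu>. a * (weak_grad \<Omega> v x \<bullet> weak_grad \<Omega> z x) + b * (weak_grad \<Omega> v x \<bullet> weak_grad \<Omega> w x))"
  proof (rule integral_cong_AE)
    show "AE x in \<mu>. weak_grad \<Omega> v x \<bullet> weak_grad \<Omega> (\<lambda>x. a * z x + b * w x) x
        = a * (weak_grad \<Omega> v x \<bullet> weak_grad \<Omega> z x) + b * (weak_grad \<Omega> v x \<bullet> weak_grad \<Omega> w x)"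
      using weak_grad_lincomb[OF \<Omega> z(2) w(2), of a b]
      by eventually_elim (simp add: inner_add_right)
    show "(\<lambda>x. weak_grad \<Omega> v x \<bullet> weak_grad \<Omega> (\<lambda>x. a * z x + b * w x) x) \<in> borel_measurable \<mu>"
      by (rule borel_measurable_integrable[OF L2_integrable_inner[OF G(1,4)]])
    show "(\<lambda>x. a * (weak_grad \<Omega> v x \<bullet> weak_grad \<Omega> z x) + b * (weak_grad \<Omega> v x \<bullet> weak_grad \<Omega> w x)) \<in> borel_measurable \<mu>"
      using borel_measurable_integrable[OF L2_integrable_inner[OF G(1,2)]]
        borel_measurable_integrable[OF L2_integrable_inner[OF G(1,3)]] by simp
  qed
  also have "\<dots> = a * (LINT x|\<mu>. weak_grad \<Omega> v x \<bullet> weak_grad \<Omega> z x) + b * (LINT x|\<mu>. weak_grad \<Omega> v x \<bullet> weak_grad \<Omega> w x)"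
    using L2_integrable_inner[OF G(1,2)] L2_integrable_inner[OF G(1,3)] by simp
  finally have 1: "(LINT x|\<mu>. weak_grad \<Omega> v x \<bullet> weak_grad \<Omega> (\<lambda>x. a * z x + b * w x) x) = \<dots>" .
  have c: "(\<lambda>x. 1 - 2 * v x) \<in> L2 \<mu>" by (rule L2_one_minus_double[OF v])
  have i: "integrable \<mu> (\<lambda>x. (1 - 2 * v x) * z x)" "integrable \<mu> (\<lambda>x. (1 - 2 * v x) * w x)"
    using L2_integrable_inner[OF c H1_L2[OF \<Omega> z(2)]] L2_integrable_inner[OF c H1_L2[OF \<Omega> w(2)]] by simp_all
  have "(1 - 2 * v x) * (a * z x + b * w x) = a * ((1 - 2 * v x) * z x) + b * ((1 - 2 * v x) * w x)" for x
    by (simp add: algebra_simps)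
  then have 2: "(LINT x|\<mu>. (1 - 2 * v x) * (a * z x + b * w x))
      = a * (LINT x|\<mu>. (1 - 2 * v x) * z x) + b * (LINT x|\<mu>. (1 - 2 * v x) * w x)"
    using i by simp
  show ?thesis
    unfolding dJ_eq 1 2 form_Linf_lincomb[OF z(1) w(1) eN_L2[OF assms(1)] eN_L2[OF assms(1)]]
      form_Linf_lincomb[OF z(1) w(1) eD_L2[OF assms(1)] eD_L2[OF assms(1)]]
    by (simp add: algebra_simps diff_divide_distrib add_divide_distrib)
qed

text \<open>Both parts of \<open>X_norm\<close> are used: the energy densities are merely
  integrable, so their terms need the supremum norm of the direction, while the gradient term needs
  the H1 norm.\<close>

lemma dJ_bounded:
  assumes v: "v \<in> phase_functions \<Omega>" "v \<in> X_space \<Omega>"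
  shows "\<exists>B. \<forall>z\<in>X_space \<Omega>. \<bar>dJ v z\<bar> \<le> B * X_norm \<Omega> z"
proof -
  have vH: "v \<in> H1 \<Omega>" using v(2) by (simp add: X_space_def)
  define BE where "BE E = \<Lambda> * (sqrt (LINT x|\<mu>. (norm (E x))\<^sup>2) * sqrt (LINT x|\<mu>. (norm (E x))\<^sup>2))"
    for E :: "real^'n \<Rightarrow> real^'n^'n"
  define B1 where "B1 = sqrt (LINT x|\<mu>. (norm (weak_grad \<Omega> v x))\<^sup>2)"
  define B2 where "B2 = sqrt (LINT x|\<mu>. (norm (1 - 2 * v x))\<^sup>2)"
  have B: "0 \<le> BE E" "0 \<le> B1" "0 \<le> B2" for E using bound_nonneg by (simp_all add: BE_def B1_def B2_def)
  have "\<bar>dJ v z\<bar> \<le> (\<bar>(\<delta> - 1) / 2\<bar> * BE (eD v) + \<bar>(\<delta> - 1) / 2\<bar> * BE (eN v)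
      + \<bar>2 * \<gamma> * \<epsilon>\<bar> * B1 + \<bar>\<gamma> / \<epsilon>\<bar> * B2) * X_norm \<Omega> z" if zX: "z \<in> X_space \<Omega>" for z
  proof -
    let ?X = "X_norm \<Omega> z"
    have z: "z \<in> Linf \<mu>" "z \<in> H1 \<Omega>" using zX by (auto simp: X_space_def)
    note X = X_norm_bounds[OF \<Omega> zX]
    have F: "\<bar>form z E E\<bar> \<le> BE E * ?X" if "E \<in> L2 \<mu>" for E
    proof -
      have "\<bar>form z E E\<bar> \<le> Linf_norm \<mu> z * BE E"
        using form_bound[OF Linf_borel_measurable[OF z(1)] AE_abs_le_Linf_norm[OF z(1)] that that X(1)]
        by (simp only: BE_def mult.assoc)
      also have "\<dots> \<le> ?X * BE E" by (rule mult_right_mono[OF X(2) B(1)])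
      finally show ?thesis by (simp only: mult.commute)
    qed
    have H: "sqrt (LINT x|\<mu>. (norm (z x))\<^sup>2) \<le> ?X" "sqrt (LINT x|\<mu>. (norm (weak_grad \<Omega> z x))\<^sup>2) \<le> ?X"
    proof -
      have "0 \<le> (LINT x|\<mu>. (z x)\<^sup>2)" "0 \<le> (LINT x|\<mu>. (norm (weak_grad \<Omega> z x))\<^sup>2)" by simp_all
      then have "sqrt (LINT x|\<mu>. (z x)\<^sup>2) \<le> H1_norm \<Omega> z"
        "sqrt (LINT x|\<mu>. (norm (weak_grad \<Omega> z x))\<^sup>2) \<le> H1_norm \<Omega> z"
        using H1_norm_square[OF \<Omega> z(2)] H1_norm_nonneg[of \<Omega> z] by (intro real_le_lsqrt; linarith)+
      with X(3) show "sqrt (LINT x|\<mu>. (norm (z x))\<^sup>2) \<le> ?X"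
        "sqrt (LINT x|\<mu>. (norm (weak_grad \<Omega> z x))\<^sup>2) \<le> ?X" by simp_all
    qed
    have g: "\<bar>LINT x|\<mu>. weak_grad \<Omega> v x \<bullet> weak_grad \<Omega> z x\<bar> \<le> B1 * ?X"
      using Cauchy_Schwarz_integral[OF weak_grad_L2[OF \<Omega> vH] weak_grad_L2[OF \<Omega> z(2)]]
        mult_left_mono[OF H(2) B(2)] unfolding B1_def by linarith
    have p: "\<bar>LINT x|\<mu>. (1 - 2 * v x) * z x\<bar> \<le> B2 * ?X"
      using Cauchy_Schwarz_integral[OF L2_one_minus_double[OF vH] H1_L2[OF \<Omega> z(2)]]
        mult_left_mono[OF H(1) B(3)] unfolding B2_def inner_real_def by linarith
    let ?a = "form z (eD v) (eD v)" and ?b = "form z (eN v) (eN v)"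
      and ?c = "LINT x|\<mu>. weak_grad \<Omega> v x \<bullet> weak_grad \<Omega> z x" and ?d = "LINT x|\<mu>. (1 - 2 * v x) * z x"
    have "\<bar>dJ v z\<bar> \<le> \<bar>(\<delta> - 1) / 2 * ?a\<bar> + \<bar>(\<delta> - 1) / 2 * ?b\<bar> + \<bar>2 * \<gamma> * \<epsilon> * ?c\<bar> + \<bar>\<gamma> / \<epsilon> * ?d\<bar>"
      unfolding dJ_eq by linarith
    also have "\<dots> = \<bar>(\<delta> - 1) / 2\<bar> * \<bar>?a\<bar> + \<bar>(\<delta> - 1) / 2\<bar> * \<bar>?b\<bar> + \<bar>2 * \<gamma> * \<epsilon>\<bar> * \<bar>?c\<bar> + \<bar>\<gamma> / \<epsilon>\<bar> * \<bar>?d\<bar>"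
      by (simp only: abs_mult)
    also have "\<dots> \<le> \<bar>(\<delta> - 1) / 2\<bar> * (BE (eD v) * ?X) + \<bar>(\<delta> - 1) / 2\<bar> * (BE (eN v) * ?X)
        + \<bar>2 * \<gamma> * \<epsilon>\<bar> * (B1 * ?X) + \<bar>\<gamma> / \<epsilon>\<bar> * (B2 * ?X)"
      by (intro add_mono mult_left_mono F g p eD_L2 eN_L2 v abs_ge_zero)
    finally show ?thesis by (simp only: distrib_right mult.assoc)
  qed
  then show ?thesis by blast
qed

section \<open>The derivative on K and the variational inequality\<close>

lemma has_frechet_deriv_in_dJ:
  assumes v: "v \<in> K_set \<Omega> d"
  shows "has_frechet_deriv_in \<Omega> (K_set \<Omega> d) J v (dJ v)"
  unfolding has_frechet_deriv_in_def
proof (intro conjI ballI allI impI)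
  have vX: "v \<in> phase_functions \<Omega>" "v \<in> X_space \<Omega>" using K_set_subset[OF \<Omega>] v by blast+
  show "dJ v (\<lambda>x. a * z x + b * w x) = a * dJ v z + b * dJ v w"
    if "z \<in> X_space \<Omega>" "w \<in> X_space \<Omega>" for a b z w
    by (rule dJ_lincomb[OF vX that])
  show "\<exists>B. \<forall>z\<in>X_space \<Omega>. \<bar>dJ v z\<bar> \<le> B * X_norm \<Omega> z" by (rule dJ_bounded[OF vX])
  fix e :: real assume e: "e > 0"
  obtain c where c: "\<And>z. z \<in> X_space \<Omega> \<Longrightarrow> (\<lambda>x. v x + z x) \<in> phase_functions \<Omega> \<Longrightarrow>
      \<bar>J (\<lambda>x. v x + z x) - J v - dJ v z\<bar> \<le> c * (X_norm \<Omega> z)\<^sup>2"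
    using J_remainder[OF vX] by blast
  show "\<exists>r>0. \<forall>z\<in>admissible_directions (K_set \<Omega> d) v. X_norm \<Omega> z < r \<longrightarrow>
      \<bar>J (\<lambda>x. v x + z x) - J v - dJ v z\<bar> \<le> e * X_norm \<Omega> z"
  \<comment> \<open>The remainder c X^2 is below e X once |c| X is below e. The constant
    \<open>c\<close> was obtained without a sign and may be 0, hence the absolute value and the
    added 1.\<close>
  proof (intro exI[of _ "e / (\<bar>c\<bar> + 1)"] conjI ballI impI)
    show "0 < e / (\<bar>c\<bar> + 1)" using e by simp
    fix z assume z: "z \<in> admissible_directions (K_set \<Omega> d) v" and small: "X_norm \<Omega> z < e / (\<bar>c\<bar> + 1)"
    have zX: "z \<in> X_space \<Omega>" by (rule admissible_direction_K_set(1)[OF \<Omega> v z])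
    note X = X_norm_bounds(4)[OF \<Omega> zX]
    have "(\<lambda>x. v x + z x) \<in> K_set \<Omega> d" using z by (simp add: admissible_directions_def add.commute)
    then have "(\<lambda>x. v x + z x) \<in> phase_functions \<Omega>" using K_set_subset[OF \<Omega>] by blast
    from c[OF zX this] have "\<bar>J (\<lambda>x. v x + z x) - J v - dJ v z\<bar> \<le> c * X_norm \<Omega> z * X_norm \<Omega> z"
      by (simp add: power2_eq_square mult.assoc)
    also have "\<dots> \<le> e * X_norm \<Omega> z"
    proof (rule mult_right_mono[OF _ X])
      have "c * X_norm \<Omega> z \<le> (\<bar>c\<bar> + 1) * X_norm \<Omega> z" using X by (intro mult_right_mono) auto
      also have "\<dots> \<le> e" using small by (simp add: pos_less_divide_eq mult.commute)
      finally show "c * X_norm \<Omega> z \<le> e" .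
    qed
    finally show "\<bar>J (\<lambda>x. v x + z x) - J v - dJ v z\<bar> \<le> e * X_norm \<Omega> z" .
  qed
qed

text \<open>The chosen derivative and \<open>dJ v\<close> are both limits of the same difference
  quotient from the right, and limits are unique.\<close>

lemma frechet_deriv_in_eq_dJ:
  assumes v: "v \<in> K_set \<Omega> d" and z: "z \<in> admissible_directions (K_set \<Omega> d) v"
  shows "frechet_deriv_in \<Omega> (K_set \<Omega> d) J v z = dJ v z"
proof -
  note D = has_frechet_deriv_in_dJ[OF v]
  have D': "has_frechet_deriv_in \<Omega> (K_set \<Omega> d) J v (frechet_deriv_in \<Omega> (K_set \<Omega> d) J v)"
    unfolding frechet_deriv_in_def by (rule someI[of "has_frechet_deriv_in \<Omega> (K_set \<Omega> d) J v", OF D])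
  note dir = has_frechet_deriv_in_imp_directional[OF \<Omega> _ admissible_direction_K_set[OF \<Omega> v z]]
  show ?thesis
    by (rule tendsto_unique[OF _ dir[OF D'] dir[OF D]]) simp
qed

text \<open>For small positive t the function v + t z competes with the minimizer, so the difference
  quotients are nonnegative and so is their limit.\<close>

lemma frechet_deriv_in_nonneg:
  assumes v: "v \<in> K_set \<Omega> d" and min: "\<And>w. w \<in> K_set \<Omega> d \<Longrightarrow> J v \<le> J w"
    and z: "z \<in> admissible_directions (K_set \<Omega> d) v"
  shows "0 \<le> frechet_deriv_in \<Omega> (K_set \<Omega> d) J v z"
  unfolding frechet_deriv_in_eq_dJ[OF v z]
proof (rule tendsto_lowerbound)
  show "((\<lambda>t. (J (\<lambda>x. v x + t * z x) - J v) / t) \<longlongrightarrow> dJ v z) (at_right 0)"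
    by (rule has_frechet_deriv_in_imp_directional[OF \<Omega> has_frechet_deriv_in_dJ[OF v]
          admissible_direction_K_set[OF \<Omega> v z]])
  have "eventually (\<lambda>t::real. t < 1) (at_right 0)"
    by (rule order_tendstoD(2)[OF tendsto_ident_at]) simp
  moreover have "eventually (\<lambda>t::real. 0 < t) (at_right 0)" by (rule eventually_at_right_less)
  ultimately show "\<forall>\<^sub>F t in at_right 0. 0 \<le> (J (\<lambda>x. v x + t * z x) - J v) / t"
  proof eventually_elim
    case (elim t)
    then have "(\<lambda>x. t * z x) \<in> admissible_directions (K_set \<Omega> d) v"
      by (intro admissible_direction_K_set(2)[OF \<Omega> v z]) auto
    then have "(\<lambda>x. v x + t * z x) \<in> K_set \<Omega> d" by (simp add: admissible_directions_def add.commute)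
    from min[OF this] elim show ?case by simp
  qed
qed simp

end

theorem theorem4p10:
  fixes \<Omega> \<Sigma>N \<Sigma>D :: "(real^'n::finite) set"
    and C0 :: "real^'n \<Rightarrow> real^'n^'n^'n^'n"
    and g f uf :: "real^'n \<Rightarrow> real^'n"
    and uN uD :: "(real^'n \<Rightarrow> real) \<Rightarrow> real^'n \<Rightarrow> real^'n"
    and \<xi>0 d0 \<alpha> \<gamma> \<delta> \<epsilon> :: real
    and K :: "(real^'n \<Rightarrow> real) set"
    and J :: "(real^'n \<Rightarrow> real) \<Rightarrow> real"
  assumes dim: "CARD('n) = 2 \<or> CARD('n) = 3"
    and domain: "bounded_lipschitz_domain \<Omega>"
    and boundary: "frontier \<Omega> = \<Sigma>N \<union> \<Sigma>D" "closed \<Sigma>D" "\<Sigma>N \<in> sets surface_measure"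
      "emeasure surface_measure \<Sigma>N > 0" "emeasure surface_measure \<Sigma>D > 0"
    and tensor: "\<xi>0 > 0" "elasticity_tensor \<Omega> \<xi>0 C0"
    and g: "g \<in> L2 (surface_on \<Sigma>N)"
    and f: "uf \<in> H1_vanishing_on \<Omega> \<Sigma>D" "AE x in surface_on \<Sigma>N. bdry_trace \<Omega> uf x = f x"
    and params: "d0 > 0" "\<alpha> > 0" "\<gamma> = 4 / pi * \<alpha>" "\<delta> > 0" "\<epsilon> > 0"
    and uN: "\<And>v. v \<in> phase_functions \<Omega> \<Longrightarrow> neumann_solution \<Omega> \<Sigma>N \<Sigma>D g (C_delta C0 \<delta> v) (uN v)"
    and uD: "\<And>v. v \<in> phase_functions \<Omega> \<Longrightarrow> dirichlet_solution \<Omega> uf (C_delta C0 \<delta> v) (uD v)"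
    and K: "K = K_set \<Omega> d0"
    and J: "J = J_func \<Omega> \<Sigma>N C0 g f uN uD \<gamma> \<delta> \<epsilon>"
  shows "(\<forall>v\<in>K. (\<exists>D. has_frechet_deriv_in \<Omega> K J v D) \<and>
            (\<forall>\<theta>\<in>admissible_directions K v.
               frechet_deriv_in \<Omega> K J v \<theta> =
                 1/2 * (LINT x|lebesgue_on \<Omega>. \<theta> x *
                   (tensor_apply (\<delta> *\<^sub>R C0 x - C0 x) (strain \<Omega> (uD v) x) \<bullet> strain \<Omega> (uD v) x))
                 - 1/2 * (LINT x|lebesgue_on \<Omega>. \<theta> x *
                   (tensor_apply (\<delta> *\<^sub>R C0 x - C0 x) (strain \<Omega> (uN v) x) \<bullet> strain \<Omega> (uN v) x))
                 + 2 * \<gamma> * \<epsilon> * (LINT x|lebesgue_on \<Omega>. weak_grad \<Omega> v x \<bullet> weak_grad \<Omega> \<theta> x)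
                 + \<gamma> / \<epsilon> * (LINT x|lebesgue_on \<Omega>. (1 - 2 * v x) * \<theta> x)))
       \<and> (\<forall>v. is_arg_min J (\<lambda>w. w \<in> K) v \<longrightarrow>
            (\<forall>\<omega>\<in>K. frechet_deriv_in \<Omega> K J v (\<lambda>x. \<omega> x - v x) \<ge> 0))"
proof -
  obtain \<Lambda> where \<Lambda>: "bounded_coercive_tensor (lebesgue_on \<Omega>) C0 \<Lambda> \<xi>0"
    using elasticity_tensor_bounded_coercive[OF tensor] by blast
  have \<Omega>: "open \<Omega>" "bounded \<Omega>"
    using domain by (simp_all add: bounded_lipschitz_domain_def)
  have "phase_field_axioms \<Omega> C0 \<Sigma>N \<Sigma>D g uf uN uD \<delta>"
    using f(1) by unfold_locales (use \<Omega> params uN uD in \<open>auto simp: H1_vanishing_on_def\<close>)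
  with \<Lambda> interpret pf: phase_field \<Omega> C0 \<Lambda> \<xi>0 \<Sigma>N \<Sigma>D g f uf uN uD \<gamma> \<delta> \<epsilon>
    by (rule phase_field.intro)
  show ?thesis
    unfolding K J
  proof (intro conjI ballI allI impI)
    fix v assume v: "v \<in> K_set \<Omega> d0"
    show "\<exists>D. has_frechet_deriv_in \<Omega> (K_set \<Omega> d0) pf.J v D"
      using pf.has_frechet_deriv_in_dJ[OF v] by blast
    fix \<theta> assume "\<theta> \<in> admissible_directions (K_set \<Omega> d0) v"
    from pf.frechet_deriv_in_eq_dJ[OF v this]
    show "frechet_deriv_in \<Omega> (K_set \<Omega> d0) pf.J v \<theta> =
                 1/2 * (LINT x|lebesgue_on \<Omega>. \<theta> x *
                   (tensor_apply (\<delta> *\<^sub>R C0 x - C0 x) (strain \<Omega> (uD v) x) \<bullet> strain \<Omega> (uD v) x))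
                 - 1/2 * (LINT x|lebesgue_on \<Omega>. \<theta> x *
                   (tensor_apply (\<delta> *\<^sub>R C0 x - C0 x) (strain \<Omega> (uN v) x) \<bullet> strain \<Omega> (uN v) x))
                 + 2 * \<gamma> * \<epsilon> * (LINT x|lebesgue_on \<Omega>. weak_grad \<Omega> v x \<bullet> weak_grad \<Omega> \<theta> x)
                 + \<gamma> / \<epsilon> * (LINT x|lebesgue_on \<Omega>. (1 - 2 * v x) * \<theta> x)"
      unfolding pf.dJ_def .
  next
    fix v \<omega> assume min: "is_arg_min pf.J (\<lambda>w. w \<in> K_set \<Omega> d0) v" and \<omega>: "\<omega> \<in> K_set \<Omega> d0"
    show "0 \<le> frechet_deriv_in \<Omega> (K_set \<Omega> d0) pf.J v (\<lambda>x. \<omega> x - v x)"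
    proof (rule pf.frechet_deriv_in_nonneg)
      show "v \<in> K_set \<Omega> d0" using min by (simp add: is_arg_min_def)
      \<comment> \<open>\<open>is_arg_min\<close> only excludes strictly smaller values; linearity
        of the order on the reals turns this into an inequality.\<close>
      show "pf.J v \<le> pf.J w" if "w \<in> K_set \<Omega> d0" for w
        using min that by (auto simp: is_arg_min_def not_less)
      show "(\<lambda>x. \<omega> x - v x) \<in> admissible_directions (K_set \<Omega> d0) v"
        using \<omega> by (simp add: admissible_directions_def)
    qed
  qed
qed

end
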